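(* Let $m\ge2$ and $0<p<q<\infty$. For every entire function $F:\mathbb C^m\to\mathbb C$ with $F\in L^p(\gamma_m)$, $$\left(\int_{\mathbb C^m}\left|F\!\left(\sqrt{\tfrac pq}\,\xi\right)\right|^q d\gamma_m(\xi)\right)^{1/q}\le\left(\int_{\mathbb C^m}|F(\xi)|^p\,d\gamma_m(\xi)\right)^{1/p}.$$
   Context: $d\gamma_m(\xi)=\pi^{-m}e^{-|\xi|^2}\,d\lambda_{2m}(\xi)$ is the standard complex Gaussian probability measure on $\mathbb C^m$, where $\lambda_{2m}$ is Lebesgue measure on $\mathbb C^m\simeq\mathbb R^{2m}$. *)

theory Defs
  imports "HOL-Analysis.Analysis"
begin

text \<open>
  Entire functions of several complex variables: at every point the function has a (real)
  Frechet derivative that is complex-linear. Additivity of \<open>D\<close> is part of \<open>has_derivative\<close>.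
\<close>

definition entire_cn :: "(complex ^ 'm \<Rightarrow> complex) \<Rightarrow> bool" where
  "entire_cn F \<longleftrightarrow>
     (\<forall>z. \<exists>D. (F has_derivative D) (at z) \<and> (\<forall>c v. D (c *s v) = c * D v))"

text \<open>
  Here \<open>lborel\<close> is the Lebesgue measure of \<open>complex ^ 'm\<close> as a Euclidean space of real
  dimension \<open>2 * CARD('m)\<close>, and \<open>norm\<close> is the Hermitian norm.
\<close>

definition complex_gaussian :: "(complex ^ 'm) measure" where
  "complex_gaussian = density lborel (\<lambda>\<xi>. ennreal (exp (- (norm \<xi>)\<^sup>2) / pi ^ CARD('m)))"

definition in_Lp :: "real \<Rightarrow> 'a measure \<Rightarrow> ('a \<Rightarrow> complex) \<Rightarrow> bool" where
  "in_Lp p M f \<longleftrightarrow> f \<in> borel_measurable M \<and> integrable M (\<lambda>x. norm (f x) powr p)"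

end

theory Submission
  imports Defs "HOL-Complex_Analysis.Complex_Analysis" "HOL-Probability.Distributions"
begin

text \<open>
  Why the dilation by \<open>sqrt (p / q)\<close> contracts \<open>L\<^sup>p\<close> into \<open>L\<^sup>q\<close>. Suppose first that \<open>p / q = k / n\<close>
  with natural numbers \<open>k \<le> n\<close>. Take independent standard Gaussian vectors \<open>x 0, \<dots>, x (n - 1)\<close>, and
  for every \<open>k\<close>-element set \<open>S\<close> of indices let \<open>s S\<close> be the sum of the \<open>x i\<close> over \<open>S\<close>, divided by
  \<open>sqrt k\<close>. Let \<open>K\<close> be the number of sets \<open>S\<close> that contain a given index, and put
  \<open>G = (\<Prod>S. F (s S))\<close>. The mean of \<open>norm G powr (p / K)\<close> is estimated in two ways.

  From above: every index lies in exactly \<open>K\<close> of the sets, so Finner's form of Hoelder's inequality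
  (\<open>nn_integral_PiM_Finner\<close>) bounds the mean by a power of the mean of \<open>norm F powr p\<close>, because each
  \<open>s S\<close> is a standard Gaussian vector.

  From below: \<open>G\<close> is an entire function of the tuple \<open>x\<close>, hence \<open>norm G powr (p / K)\<close> is
  plurisubharmonic. Conditionally on the normalised total sum \<open>s\<close>, the tuple is \<open>(s, \<dots>, s) / sqrt n\<close>
  plus a vector whose law is invariant under multiplication by phases, so the conditional mean is at
  least the value at \<open>(s, \<dots>, s) / sqrt n\<close> (\<open>complex_gaussian_PiM_diagonal_le\<close>). There every factor of
  \<open>G\<close> equals \<open>F (sqrt (k / n) s)\<close>, and since there are \<open>K * n / k\<close> sets, the value is
  \<open>norm (F (sqrt (k / n) s)) powr q\<close>.

  Comparing the two bounds gives the theorem for rational \<open>p / q\<close>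
  (\<open>hypercontractive_rational_powers\<close>). The general case follows by monotonicity of the
  \<open>L\<^sup>p\<close>-norms and Fatou's lemma (\<open>hypercontractive_nn_integral\<close>).

  The inputs are the subharmonicity of \<open>norm g powr \<delta>\<close> for an entire function \<open>g\<close> of one variable
  (\<open>mean_value_le_powr\<close>) and the invariance of the Gaussian measure under reflections of pairs
  (\<open>complex_gaussian_pair_reflection\<close>), from which invariance under phases is deduced.
\<close>

section \<open>Subharmonicity of powers of the modulus in one variable\<close>

text \<open>
Without zeros in the open disc, \<open>g\<close> has a holomorphic power \<open>h = exp (\<delta> * log g)\<close> there, and
the mean value property of \<open>h\<close> together with the triangle inequality gives the claim on every
circle of radius \<open>r < 1\<close>. Zeros on the unit circle itself are allowed, which is why the radius is
sent to \<open>1\<close> only at the end.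
\<close>

lemma mean_value_le_nonvanishing:
  fixes g :: "complex \<Rightarrow> complex"
  assumes holo: "g holomorphic_on UNIV" and nz: "\<And>z. z \<in> ball 0 1 \<Longrightarrow> g z \<noteq> 0" and "\<delta> > 0"
  shows "norm (g 0) powr \<delta> \<le> integral {0..1} (\<lambda>t. norm (g (cis (2 * pi * t))) powr \<delta>)"
proof -
  define M where "M r = integral {0..1} (\<lambda>t. norm (g (of_real r * cis (2 * pi * t))) powr \<delta>)" for r :: real
  have contg: "continuous_on UNIV g"
    using holo by (rule holomorphic_on_imp_continuous_on)
  have contp: "continuous_on S (\<lambda>x. norm (g (\<phi> x)) powr \<delta>)" if "continuous_on S \<phi>" for S and \<phi> :: "'b::topological_space \<Rightarrow> complex"
    using \<open>\<delta> > 0\<close> by (intro continuous_on_powr' continuous_intros continuous_on_compose2[OF contg that]) auto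
  have "continuous_on {0..1} M"
    unfolding M_def
    by (rule integral_continuous_on_param[of "{0..1}" "0::real" 1, simplified])
       (auto simp: case_prod_beta intro!: contp continuous_intros)
  then have lim: "(M \<longlongrightarrow> M 1) (at 1 within {0..1})"
    by (auto simp: continuous_on_def)
  obtain L where L: "L holomorphic_on ball 0 1" "\<And>z. z \<in> ball 0 1 \<Longrightarrow> exp (L z) = g z"
    by (rule holomorphic_logarithm_exists[of "ball 0 1" g 0])
       (use nz in \<open>auto intro: holomorphic_on_subset[OF holo]\<close>)
  define h where "h z = exp (of_real \<delta> * L z)" for z
  have hh: "h holomorphic_on ball 0 1"
    unfolding h_def by (intro holomorphic_intros L)
  have normh: "norm (h z) = norm (g z) powr \<delta>" if "z \<in> ball 0 1" for z
    unfolding h_def L(2)[OF that, symmetric] by (simp add: powr_def)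
  \<comment> \<open>Cauchy's formula at the centre of the circle of radius \<open>r\<close>, applied to \<open>h\<close>.\<close>
  have le: "norm (g 0) powr \<delta> \<le> M r" if "0 < r" "r < 1" for r
  proof -
    have "h holomorphic_on cball 0 r"
      by (rule holomorphic_on_subset[OF hh]) (use that in auto)
    then have "((\<lambda>u. h u / (u - 0)) has_contour_integral (2 * of_real pi * \<i> * h 0)) (circlepath 0 r)"
      by (rule Cauchy_integral_circlepath_simple) (use that in auto)
    then have "((\<lambda>t. h (of_real r * cis (2 * pi * t)) * (2 * of_real pi * \<i>)) has_integral (2 * of_real pi * \<i> * h 0)) {0..1}"
      unfolding has_contour_integral_def
    proof (rule has_integral_eq[rotated])
      fix t :: real assume "t \<in> {0..1}"
      then have "vector_derivative (circlepath 0 r) (at t within {0..1}) = (2 * of_real pi * \<i>) * (of_real r * cis (2 * pi * t))"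
        by (simp add: vector_derivative_circlepath01 cis_conv_exp mult_ac)
      moreover have "circlepath 0 r t = of_real r * cis (2 * pi * t)"
        by (simp add: circlepath cis_conv_exp mult_ac)
      ultimately show "h (circlepath 0 r t) / (circlepath 0 r t - 0) * vector_derivative (circlepath 0 r) (at t within {0..1})
          = h (of_real r * cis (2 * pi * t)) * (2 * of_real pi * \<i>)"
        using that by simp
    qed
    from has_integral_mult_left[OF this, of "1 / (2 * of_real pi * \<i>)"]
    have I: "((\<lambda>t. h (of_real r * cis (2 * pi * t))) has_integral h 0) {0..1}"
      by simp
    have "norm (integral {0..1} (\<lambda>t. h (of_real r * cis (2 * pi * t)))) \<le> M r"
      unfolding M_def
    proof (rule integral_norm_bound_integral)
      show "(\<lambda>t. norm (g (of_real r * cis (2 * pi * t))) powr \<delta>) integrable_on {0..1}"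
        by (intro integrable_continuous_real contp continuous_intros)
    qed (use I that normh in \<open>auto simp: norm_mult\<close>)
    then show ?thesis
      using integral_unique[OF I] normh[of 0] by simp
  qed
  have "norm (g 0) powr \<delta> \<le> M 1"
  proof (rule tendsto_lowerbound[OF lim])
    show "\<forall>\<^sub>F r in at 1 within {0..1}. norm (g 0) powr \<delta> \<le> M r"
      unfolding eventually_at by (rule exI[of _ "1/2"]) (auto intro!: le simp: dist_real_def)
    show "at (1::real) within {0..1} \<noteq> bot"
      by (simp add: at_within_Icc_at_left)
  qed
  then show ?thesis by (simp add: M_def)
qed

lemma entire_factor_zero:
  fixes g :: "complex \<Rightarrow> complex"
  assumes holo: "g holomorphic_on UNIV" and "g w \<noteq> 0" "g a = 0"
  obtains n k where "k holomorphic_on UNIV" "k a \<noteq> 0" "\<And>z. g z = (z - a) ^ n * k z"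
proof -
  obtain r where r: "r > 0" "zor_poly g a holomorphic_on cball a r"
     "\<And>z. z \<in> cball a r \<Longrightarrow> g z = zor_poly g a z * (z - a) ^ nat (zorder g a) \<and> zor_poly g a z \<noteq> 0"
    using zorder_exist_zero[OF holo open_UNIV connected_UNIV UNIV_I, of a] assms(2) by blast
  define n where "n = nat (zorder g a)"
  define k where "k z = (if z \<in> ball a r then zor_poly g a z else g z / (z - a) ^ n)" for z
  have eq: "k z = g z / (z - a) ^ n" if "z \<noteq> a" for z
    using r(3)[of z] that by (auto simp: k_def n_def)
  have 1: "k holomorphic_on ball a r"
    by (rule holomorphic_transform[OF holomorphic_on_subset[OF r(2)]]) (auto simp: k_def)
  have 2: "k holomorphic_on - {a}"
    by (rule holomorphic_transform[of "\<lambda>z. g z / (z - a) ^ n"])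
       (auto simp: eq intro!: holomorphic_intros holomorphic_on_subset[OF holo])
  have "k holomorphic_on ball a r \<union> - {a}"
    using 1 2 by (intro holomorphic_on_Un) auto
  moreover have "ball a r \<union> - {a} = UNIV" using r(1) by auto
  ultimately have "k holomorphic_on UNIV" by simp
  moreover have "k a \<noteq> 0" using r(1) r(3)[of a] by (auto simp: k_def)
  moreover have "g z = (z - a) ^ n * k z" for z
    using r(1) r(3)[of a] eq[of z] by (cases "z = a") (auto simp: k_def n_def)
  ultimately show ?thesis using that by blast
qed

text \<open>
The modulus identity behind Blaschke factors: on the unit circle a zero \<open>a\<close> can be exchanged
for its mirror image without changing the modulus.
\<close>

lemma norm_diff_unit_circle:
  fixes a z :: complex
  assumes "norm z = 1"
  shows "norm (z - a) = norm (1 - cnj a * z)"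
proof -
  have "z - a = z * cnj (1 - cnj a * z)"
    using assms by (simp add: algebra_simps complex_norm_square[symmetric])
  then have "norm (z - a) = norm z * norm (cnj (1 - cnj a * z))"
    by (metis norm_mult)
  then show ?thesis using assms by (simp only: complex_mod_cnj mult_1)
qed

text \<open>
The function \<open>norm g powr \<delta>\<close> is subharmonic for every \<open>\<delta> > 0\<close>. Zeros in the open disc are
removed one point at a time: replacing \<open>(z - a) ^ n\<close> by \<open>(1 - cnj a * z) ^ n\<close> leaves the modulus
on the unit circle unchanged, does not decrease it at \<open>0\<close>, and moves the zero out of the disc.
\<close>

lemma mean_value_le_powr:
  fixes g :: "complex \<Rightarrow> complex"
  assumes "g holomorphic_on UNIV" and "\<delta> > 0"
  shows "norm (g 0) powr \<delta> \<le> integral {0..1} (\<lambda>t. norm (g (cis (2 * pi * t))) powr \<delta>)"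
  using assms(1)
proof (induction "card {z \<in> ball 0 1. g z = 0}" arbitrary: g rule: less_induct)
  case less
  show ?case
  proof (cases "g 0 = 0 \<or> (\<forall>z \<in> ball 0 1. g z \<noteq> 0)")
    case True
    then show ?thesis
    proof
      assume "g 0 = 0"
      moreover have "0 \<le> integral {0..1} (\<lambda>t. norm (g (cis (2 * pi * t))) powr \<delta>)"
        by (cases "(\<lambda>t. norm (g (cis (2 * pi * t))) powr \<delta>) integrable_on {0..1}")
           (auto simp: not_integrable_integral intro: integral_nonneg)
      ultimately show ?thesis by simp
    next
      assume "\<forall>z \<in> ball 0 1. g z \<noteq> 0"
      then show ?thesis
        using mean_value_le_nonvanishing[OF less.prems _ \<open>\<delta> > 0\<close>] by blast
    qed
  next
    case False
    then obtain a where a: "norm a < 1" "g a = 0" and g0: "g 0 \<noteq> 0" by auto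
    obtain n k where k: "k holomorphic_on UNIV" "k a \<noteq> 0" "\<And>z. g z = (z - a) ^ n * k z"
      using entire_factor_zero[OF less.prems g0 a(2)] by blast
    define G where "G z = (1 - cnj a * z) ^ n * k z" for z
    have "\<not> g constant_on UNIV" using a(2) g0 unfolding constant_on_def by (metis UNIV_I)
    then have "finite {z \<in> cball 0 1. g z = 0}"
      using holomorphic_compact_finite_zeros[OF less.prems, of "cball 0 1"] by auto
    then have fin: "finite {z \<in> ball 0 1. g z = 0}"
      by (rule rev_finite_subset) auto
    have nz: "1 - cnj a * z \<noteq> 0" if "norm z < 1" for z
    proof
      assume "1 - cnj a * z = 0"
      then have "norm a * norm z = 1"
        by (metis complex_mod_cnj eq_iff_diff_eq_0 norm_mult norm_one)
      moreover have "norm a * norm z < 1 * 1"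
        using that a by (intro mult_strict_mono') auto
      ultimately show False by simp
    qed
    have "{z \<in> ball 0 1. G z = 0} \<subset> {z \<in> ball 0 1. g z = 0}"
      using a nz k(2) by (auto simp: G_def k(3))
    then have "card {z \<in> ball 0 1. G z = 0} < card {z \<in> ball 0 1. g z = 0}"
      using fin by (rule psubset_card_mono[rotated])
    moreover have "G holomorphic_on UNIV"
      unfolding G_def by (intro holomorphic_intros k)
    ultimately have IH: "norm (G 0) powr \<delta> \<le> integral {0..1} (\<lambda>t. norm (G (cis (2 * pi * t))) powr \<delta>)"
      using less.hyps by blast
    have "norm (g 0) \<le> norm (G 0)"
      using a by (auto simp: G_def k(3) norm_mult norm_power power_le_one intro!: mult_left_le_one_le)
    then have "norm (g 0) powr \<delta> \<le> norm (G 0) powr \<delta>"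
      using \<open>\<delta> > 0\<close> by (intro powr_mono2) auto
    moreover have "norm (G (cis t)) = norm (g (cis t))" for t
      by (simp add: G_def k(3) norm_mult norm_power norm_diff_unit_circle[of "cis t" a])
    ultimately show ?thesis using IH by simp
  qed
qed

lemma mean_value_le_powr_nn_integral:
  fixes g :: "complex \<Rightarrow> complex"
  assumes "g holomorphic_on UNIV" and "\<delta> > 0"
  shows "ennreal (norm (g 0) powr \<delta>) \<le> (\<integral>\<^sup>+t. ennreal (norm (g (cis (2 * pi * t))) powr \<delta>) * indicator {0..1} t \<partial>lborel)"
proof -
  have contg: "continuous_on UNIV g"
    using assms(1) by (rule holomorphic_on_imp_continuous_on)
  have cont: "continuous_on S (\<lambda>t. norm (g (cis (2 * pi * t))) powr \<delta>)" for S
    using \<open>\<delta> > 0\<close> by (intro continuous_on_powr' continuous_intros continuous_on_compose2[OF contg]) auto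
  let ?f = "\<lambda>t. norm (g (cis (2 * pi * t))) powr \<delta>"
  have "(?f has_integral integral {0..1} ?f) {0..1}"
    by (intro integrable_integral integrable_continuous_real cont)
  from nn_integral_has_integral_lebesgue[OF _ this]
  have "(\<integral>\<^sup>+t. ennreal (?f t) * indicator {0..1} t \<partial>lborel) = ennreal (integral {0..1} ?f)"
    by (simp add: mult.commute ennreal_mult' ennreal_indicator)
  then show ?thesis
    using mean_value_le_powr[OF assms] by (simp add: ennreal_leI)
qed

section \<open>Symmetries of the complex Gaussian measure\<close>

lemma sets_complex_gaussian [simp, measurable_cong]: "sets complex_gaussian = sets borel"
  by (simp add: complex_gaussian_def)

lemma space_complex_gaussian [simp]: "space complex_gaussian = UNIV"
  by (simp add: complex_gaussian_def)

lemma nn_integral_complex_gaussian: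
  fixes f :: "complex ^ 'm \<Rightarrow> ennreal"
  assumes "f \<in> borel_measurable borel"
  shows "(\<integral>\<^sup>+x. f x \<partial>complex_gaussian) =
    (\<integral>\<^sup>+x. ennreal (exp (- (norm x)\<^sup>2) / pi ^ CARD('m)) * f x \<partial>lborel)"
  unfolding complex_gaussian_def using assms by (subst nn_integral_density) auto

lemma prob_space_complex_gaussian: "prob_space (complex_gaussian :: (complex ^ 'm) measure)"
proof
  have 1: "(\<integral>\<^sup>+x. ennreal (exp (- x\<^sup>2) / sqrt pi) \<partial>lborel) = 1"
  proof -
    have "normal_density 0 (1 / sqrt 2) x = exp (- x\<^sup>2) / sqrt pi" for x
      by (simp add: normal_density_def power_divide)
    then show ?thesis
      using prob_space.emeasure_space_1[OF prob_space_normal_density[of "1 / sqrt 2" 0]]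
      by (simp add: emeasure_density)
  qed
  have "exp (- (norm x)\<^sup>2) / pi ^ CARD('m) = (\<Prod>b\<in>Basis. exp (- (x \<bullet> b)\<^sup>2) / sqrt pi)"
    for x :: "complex ^ 'm"
  proof -
    have "(norm x)\<^sup>2 = (\<Sum>b\<in>Basis. (x \<bullet> b)\<^sup>2)"
      by (subst power2_norm_eq_inner, subst euclidean_inner) (simp add: power2_eq_square)
    moreover have "sqrt pi ^ DIM(complex ^ 'm) = pi ^ CARD('m)"
    proof -
      have "sqrt pi ^ (2 * n) = pi ^ n" for n by (subst power_mult) simp
      then show ?thesis by (simp add: mult.commute)
    qed
    ultimately show ?thesis
      by (simp add: prod_dividef exp_sum[symmetric] sum_negf del: DIM_cart)
  qed
  then have "emeasure (complex_gaussian :: (complex ^ 'm) measure) UNIV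
      = (\<integral>\<^sup>+x. (\<Prod>b\<in>Basis. ennreal (exp (- (x \<bullet> b)\<^sup>2) / sqrt pi)) \<partial>(lborel :: (complex ^ 'm) measure))"
    by (simp add: complex_gaussian_def emeasure_density prod_ennreal)
  also have "\<dots> = 1"
    by (subst nn_integral_lborel_prod) (auto simp: 1)
  finally show "emeasure (complex_gaussian :: (complex ^ 'm) measure) (space complex_gaussian) = 1"
    by simp
qed

lemma nn_integral_lborel_affine:
  fixes f :: "'a::euclidean_space \<Rightarrow> ennreal"
  assumes [measurable]: "f \<in> borel_measurable borel" and "c \<noteq> 0"
  shows "(\<integral>\<^sup>+x. f x \<partial>lborel) = ennreal (\<bar>c\<bar> ^ DIM('a)) * (\<integral>\<^sup>+x. f (t + c *\<^sub>R x) \<partial>lborel)"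
  by (subst lborel_affine[OF assms(2), of t])
     (simp add: nn_integral_density nn_integral_distr nn_integral_cmult)

lemma nn_integral_complex_gaussian_uminus:
  fixes f :: "complex ^ 'm \<Rightarrow> ennreal"
  assumes [measurable]: "f \<in> borel_measurable borel"
  shows "(\<integral>\<^sup>+x. f (- x) \<partial>complex_gaussian) = (\<integral>\<^sup>+x. f x \<partial>complex_gaussian)"
  using nn_integral_lborel_affine[of "\<lambda>x. ennreal (exp (- (norm x)\<^sup>2) / pi ^ CARD('m)) * f x" "-1" 0]
  by (simp add: nn_integral_complex_gaussian)

text \<open>
The standard Gaussian measure on a product is invariant under orthogonal maps; here the map is
the reflection \<open>(s, v) \<mapsto> (c s + d v, d s - c v)\<close>, acting blockwise. Two affine
substitutions in one block at a time, with Fubini between them, prove the case \<open>d \<noteq> 0\<close>: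
Lebesgue measure is multiplied by a power of \<open>d\<close> and then by the inverse power.
\<close>

lemma complex_gaussian_pair_reflection:
  fixes H :: "(complex ^ 'm) \<times> (complex ^ 'm) \<Rightarrow> ennreal"
  assumes H: "H \<in> borel_measurable borel" and cd: "c\<^sup>2 + d\<^sup>2 = 1"
  shows "(\<integral>\<^sup>+x. \<integral>\<^sup>+y. H (x, y) \<partial>complex_gaussian \<partial>complex_gaussian) =
         (\<integral>\<^sup>+s. \<integral>\<^sup>+v. H (c *\<^sub>R s + d *\<^sub>R v, d *\<^sub>R s - c *\<^sub>R v) \<partial>complex_gaussian \<partial>complex_gaussian)"
proof -
  have H' [measurable]: "H \<in> borel_measurable (borel \<Otimes>\<^sub>M borel)"
    using H by (simp add: borel_prod)
  show ?thesis
  proof (cases "d = 0")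
    case True
    then consider "c = 1" | "c = - 1" using cd by (auto simp: power2_eq_1_iff)
    then show ?thesis
    proof cases
      case 1
      then show ?thesis using True
        by (simp add: nn_integral_complex_gaussian_uminus[of "\<lambda>y. H (_, y)"])
    next
      case 2
      have "(\<lambda>x. \<integral>\<^sup>+y. H (x, y) \<partial>complex_gaussian) \<in> borel_measurable borel"
        by (simp add: nn_integral_complex_gaussian) measurable
      from nn_integral_complex_gaussian_uminus[OF this] show ?thesis
        using 2 True by simp
    qed
  next
    case d: False
    define g where "g x = ennreal (exp (- (norm x)\<^sup>2) / pi ^ CARD('m))" for x :: "complex ^ 'm"
    have [measurable]: "g \<in> borel_measurable borel" by (simp add: g_def[abs_def])
    define P where "P x y = g x * g y * H (x, y)" for x y
    have [measurable]: "(\<lambda>(x, y). P x y) \<in> borel_measurable (borel \<Otimes>\<^sub>M borel)"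
      unfolding P_def by measurable
    have [measurable]: "(\<lambda>y. P (f x) (h y)) \<in> borel_measurable borel"
      if [measurable]: "h \<in> borel_measurable borel" for x f h by (simp add: P_def)
    define K' where "K' = ennreal (\<bar>1 / d\<bar> ^ DIM(complex ^ 'm))"
    have KK': "ennreal (\<bar>d\<bar> ^ (CARD('m) * 2)) * K' = 1"
      using d by (simp add: K'_def ennreal_mult[symmetric] power_mult_distrib[symmetric])
    have gg: "g (c *\<^sub>R s + d *\<^sub>R v) * g (d *\<^sub>R s - c *\<^sub>R v) = g s * g v" for s v
    proof -
      have "(norm (c *\<^sub>R s + d *\<^sub>R v))\<^sup>2 + (norm (d *\<^sub>R s - c *\<^sub>R v))\<^sup>2
         = (c\<^sup>2 + d\<^sup>2) * ((norm s)\<^sup>2 + (norm v)\<^sup>2)"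
        unfolding power2_norm_eq_inner inner_simps inner_commute[of v s] by algebra
      then show ?thesis using cd
        by (simp add: g_def ennreal_mult[symmetric] exp_add[symmetric])
    qed
    \<comment> \<open>Solving \<open>x = c s + d v\<close>, \<open>y = d s - c v\<close> for \<open>y\<close> gives \<open>y = (s - c x) / d\<close>: first trade \<open>y\<close>
      for \<open>s\<close> with \<open>x\<close> fixed, then \<open>x\<close> for \<open>v\<close> with \<open>s\<close> fixed.\<close>
    have "(\<integral>\<^sup>+x. \<integral>\<^sup>+y. H (x, y) \<partial>complex_gaussian \<partial>complex_gaussian)
        = (\<integral>\<^sup>+x. \<integral>\<^sup>+y. P x y \<partial>lborel \<partial>lborel)"
      by (simp add: nn_integral_complex_gaussian g_def[symmetric] P_def mult.assoc nn_integral_cmult[symmetric])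
    also have "\<dots> = (\<integral>\<^sup>+x. \<integral>\<^sup>+s. K' * P x ((- c / d) *\<^sub>R x + (1 / d) *\<^sub>R s) \<partial>lborel \<partial>lborel)"
    proof (rule nn_integral_cong)
      fix x :: "complex ^ 'm"
      show "(\<integral>\<^sup>+y. P x y \<partial>lborel) = (\<integral>\<^sup>+s. K' * P x ((- c / d) *\<^sub>R x + (1 / d) *\<^sub>R s) \<partial>lborel)"
        using d by (subst nn_integral_lborel_affine[of _ "1 / d" "(- c / d) *\<^sub>R x"])
          (simp_all add: K'_def nn_integral_cmult)
    qed
    also have "\<dots> = (\<integral>\<^sup>+s. \<integral>\<^sup>+x. K' * P x ((- c / d) *\<^sub>R x + (1 / d) *\<^sub>R s) \<partial>lborel \<partial>lborel)"
      by (rule lborel_pair.Fubini') measurable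
    also have "\<dots> = (\<integral>\<^sup>+s. \<integral>\<^sup>+v. P (c *\<^sub>R s + d *\<^sub>R v) (d *\<^sub>R s - c *\<^sub>R v) \<partial>lborel \<partial>lborel)"
    proof (rule nn_integral_cong)
      fix s :: "complex ^ 'm"
      have "(- c / d) *\<^sub>R (c *\<^sub>R s + d *\<^sub>R v) + (1 / d) *\<^sub>R s = d *\<^sub>R s - c *\<^sub>R v" for v
      proof -
        have "(- c / d) *\<^sub>R (c *\<^sub>R s + d *\<^sub>R v) + (1 / d) *\<^sub>R s = ((1 - c\<^sup>2) / d) *\<^sub>R s - c *\<^sub>R v"
          using d by (simp add: scaleR_add_right scaleR_diff_left diff_divide_distrib power2_eq_square)
        also have "(1 - c\<^sup>2) / d = d" using cd d by (simp add: field_simps power2_eq_square)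
        finally show ?thesis .
      qed
      then show "(\<integral>\<^sup>+x. K' * P x ((- c / d) *\<^sub>R x + (1 / d) *\<^sub>R s) \<partial>lborel)
          = (\<integral>\<^sup>+v. P (c *\<^sub>R s + d *\<^sub>R v) (d *\<^sub>R s - c *\<^sub>R v) \<partial>lborel)"
        using d KK'
        by (subst nn_integral_lborel_affine[of _ d "c *\<^sub>R s"])
           (simp_all add: nn_integral_cmult mult.assoc[symmetric])
    qed
    also have "\<dots> = (\<integral>\<^sup>+s. \<integral>\<^sup>+v. H (c *\<^sub>R s + d *\<^sub>R v, d *\<^sub>R s - c *\<^sub>R v) \<partial>complex_gaussian \<partial>complex_gaussian)"
      by (simp add: nn_integral_complex_gaussian g_def[symmetric] P_def gg mult.assoc nn_integral_cmult[symmetric])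
    finally show ?thesis .
  qed
qed
lemma prod_Basis_complex_vec:
  fixes x :: "complex ^ 'm"
  shows "(\<Prod>b\<in>Basis. x \<bullet> b) = (\<Prod>j\<in>UNIV. Re (x $ j) * Im (x $ j))"
proof -
  have "(\<Prod>b\<in>Basis. x \<bullet> b) = (\<Prod>j\<in>UNIV. \<Prod>b\<in>(\<lambda>u. axis j u) ` (Basis :: complex set). x \<bullet> b)"
  proof -
    have eq: "Basis = (\<Union>j\<in>(UNIV :: 'm set). (\<lambda>u. axis j u) ` (Basis :: complex set))"
      by (auto simp: Basis_vec_def)
    have "(\<lambda>u. axis i u) ` (Basis :: complex set) \<inter> (\<lambda>u. axis j u) ` Basis = {}" if "i \<noteq> j" for i j :: 'm
      using that by (auto simp: axis_eq_axis Basis_complex_def)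
    then show ?thesis
      unfolding eq by (intro prod.UNION_disjoint) auto
  qed
  also have "\<dots> = (\<Prod>j\<in>UNIV. Re (x $ j) * Im (x $ j))"
    by (intro prod.cong refl) (simp add: Basis_complex_def inner_axis axis_eq_axis)
  finally show ?thesis .
qed

lemma mem_box_complex_vec:
  fixes x :: "complex ^ 'm"
  shows "x \<in> box l u \<longleftrightarrow> (\<forall>j. Re (l $ j) < Re (x $ j) \<and> Re (x $ j) < Re (u $ j)
     \<and> Im (l $ j) < Im (x $ j) \<and> Im (x $ j) < Im (u $ j))"
  by (auto simp: mem_box Basis_vec_def Basis_complex_def inner_axis)

lemma continuous_on_vector_scalar_mult [continuous_intros]:
  fixes f :: "'b::topological_space \<Rightarrow> complex" and g :: "'b \<Rightarrow> complex ^ 'm"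
  assumes "continuous_on S f" "continuous_on S g"
  shows "continuous_on S (\<lambda>x. f x *s g x)"
  unfolding vector_scalar_mult_def using assms by (intro continuous_intros)

lemma norm_vector_scalar_mult: "norm (c *s v) = norm c * norm v" for v :: "complex ^ 'm"
  by (simp add: norm_vec_def norm_mult L2_set_right_distrib)

text \<open>
Multiplication by \<open>\<i>\<close> permutes the real coordinates up to sign, so it maps boxes to boxes of
the same volume.
\<close>

lemma nn_integral_lborel_times_ii:
  fixes f :: "complex ^ 'm \<Rightarrow> ennreal"
  assumes [measurable]: "f \<in> borel_measurable borel"
  shows "(\<integral>\<^sup>+x. f (\<i> *s x) \<partial>lborel) = (\<integral>\<^sup>+x. f x \<partial>lborel)"
proof -
  have [measurable]: "(\<lambda>x. \<i> *s x) \<in> borel_measurable (borel :: (complex ^ 'm) measure)"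
    by (intro borel_measurable_continuous_onI continuous_intros)
  have "lborel = distr lborel borel (\<lambda>x :: complex ^ 'm. \<i> *s x)"
  proof (rule lborel_eqI)
    fix l u :: "complex ^ 'm"
    assume le: "\<And>b. b \<in> Basis \<Longrightarrow> l \<bullet> b \<le> u \<bullet> b"
    define l' :: "complex ^ 'm" where "l' = (\<chi> j. Complex (Im (l $ j)) (- Re (u $ j)))"
    define u' :: "complex ^ 'm" where "u' = (\<chi> j. Complex (Im (u $ j)) (- Re (l $ j)))"
    have le': "Re (l $ j) \<le> Re (u $ j)" "Im (l $ j) \<le> Im (u $ j)" for j
      using le[of "axis j 1"] le[of "axis j \<i>"]
      by (auto simp: Basis_vec_def Basis_complex_def inner_axis)
    have vol: "(\<Prod>b\<in>Basis. (u' - l') \<bullet> b) = (\<Prod>b\<in>Basis. (u - l) \<bullet> b)"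
      unfolding prod_Basis_complex_vec by (intro prod.cong) (auto simp: l'_def u'_def mult_ac)
    have "(\<lambda>x. \<i> *s x) -` box l u = box l' u'"
      by (auto simp: mem_box_complex_vec l'_def u'_def) (metis minus_less_iff neg_less_iff_less)+
    moreover have "emeasure lborel (box l' u') = (\<Prod>b\<in>Basis. (u' - l') \<bullet> b)"
      by (rule emeasure_lborel_box)
         (use le' in \<open>auto simp: Basis_vec_def Basis_complex_def inner_axis l'_def u'_def\<close>)
    ultimately show "emeasure (distr lborel borel (\<lambda>x. \<i> *s x)) (box l u) = (\<Prod>b\<in>Basis. (u - l) \<bullet> b)"
      by (simp add: emeasure_distr vol)
  qed simp
  then have "(\<integral>\<^sup>+x. f x \<partial>lborel) = (\<integral>\<^sup>+x. f x \<partial>distr lborel borel (\<lambda>x. \<i> *s x))"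
    by (rule arg_cong)
  also have "\<dots> = (\<integral>\<^sup>+x. f (\<i> *s x) \<partial>lborel)"
    by (subst nn_integral_distr) auto
  finally show ?thesis by (rule sym)
qed

lemma nn_integral_complex_gaussian_times_ii:
  fixes f :: "complex ^ 'm \<Rightarrow> ennreal"
  assumes [measurable]: "f \<in> borel_measurable borel"
  shows "(\<integral>\<^sup>+x. f (\<i> *s x) \<partial>complex_gaussian) = (\<integral>\<^sup>+x. f x \<partial>complex_gaussian)"
proof -
  have [measurable]: "(\<lambda>x. \<i> *s x) \<in> borel_measurable (borel :: (complex ^ 'm) measure)"
    by (intro borel_measurable_continuous_onI continuous_intros)
  show ?thesis
    using nn_integral_lborel_times_ii[of "\<lambda>x. ennreal (exp (- (norm x)\<^sup>2) / pi ^ CARD('m)) * f x"]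
    by (subst (1 2) nn_integral_complex_gaussian) (simp_all add: norm_vector_scalar_mult)
qed

text \<open>
A combination \<open>c s + d v\<close> of independent standard Gaussian vectors is again standard Gaussian:
it is the first component of the reflected pair.
\<close>

lemma complex_gaussian_pair_combine:
  fixes f :: "complex ^ 'm \<Rightarrow> ennreal"
  assumes [measurable]: "f \<in> borel_measurable borel" and "c\<^sup>2 + d\<^sup>2 = 1"
  shows "(\<integral>\<^sup>+s. \<integral>\<^sup>+v. f (c *\<^sub>R s + d *\<^sub>R v) \<partial>complex_gaussian \<partial>complex_gaussian)
    = (\<integral>\<^sup>+x. f x \<partial>complex_gaussian)"
proof -
  interpret prob_space "complex_gaussian :: (complex ^ 'm) measure"
    by (rule prob_space_complex_gaussian)
  have "(\<lambda>z :: (complex ^ 'm) \<times> (complex ^ 'm). f (fst z)) \<in> borel_measurable borel"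
    by (simp add: borel_prod[symmetric])
  from complex_gaussian_pair_reflection[OF this assms(2)]
  have "(\<integral>\<^sup>+s. \<integral>\<^sup>+v. f (c *\<^sub>R s + d *\<^sub>R v) \<partial>complex_gaussian \<partial>complex_gaussian)
    = (\<integral>\<^sup>+x. (\<integral>\<^sup>+y. f x \<partial>(complex_gaussian :: (complex ^ 'm) measure)) \<partial>complex_gaussian)"
    by (simp only: fst_conv)
  also have "\<dots> = (\<integral>\<^sup>+x. f x \<partial>complex_gaussian)"
    using emeasure_space_1 by simp
  finally show ?thesis .
qed

text \<open>
Invariance under a phase \<open>cis \<theta>\<close>. If \<open>s\<close> and \<open>v\<close> are independent standard Gaussian vectors,
then so is \<open>(s \<plusminus> \<i> v) / sqrt 2\<close>, and
\<open>cis \<theta> * (s - \<i> v) = s' + \<i> v'\<close> where \<open>(s', v')\<close> is the image of \<open>(s, v)\<close> under a plane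
reflection. Thus a complex phase becomes a real orthogonal map of a pair of blocks.
\<close>

lemma nn_integral_complex_gaussian_rotate:
  fixes f :: "complex ^ 'm \<Rightarrow> ennreal"
  assumes [measurable]: "f \<in> borel_measurable borel"
  shows "(\<integral>\<^sup>+x. f (cis \<theta> *s x) \<partial>complex_gaussian) = (\<integral>\<^sup>+x. f x \<partial>complex_gaussian)"
proof -
  have [measurable]: "(\<lambda>x. c *s x) \<in> borel_measurable (borel :: (complex ^ 'm) measure)" for c
    by (intro borel_measurable_continuous_onI continuous_intros)
  let ?r = "1 / sqrt 2 :: real"
  have r: "?r\<^sup>2 + ?r\<^sup>2 = 1" by (simp add: power_divide)
  have "(\<integral>\<^sup>+x. f (cis \<theta> *s x) \<partial>complex_gaussian)
     = (\<integral>\<^sup>+s. \<integral>\<^sup>+v. f (cis \<theta> *s (?r *\<^sub>R s + ?r *\<^sub>R v)) \<partial>complex_gaussian \<partial>complex_gaussian)"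
    by (rule complex_gaussian_pair_combine[symmetric, OF _ r]) measurable
  also have "\<dots> = (\<integral>\<^sup>+s. \<integral>\<^sup>+v. f (cis \<theta> *s (?r *\<^sub>R s - ?r *\<^sub>R (\<i> *s v))) \<partial>complex_gaussian \<partial>complex_gaussian)"
  proof (rule nn_integral_cong)
    fix s :: "complex ^ 'm"
    have "\<i> *s (\<i> *s v) = - v" for v :: "complex ^ 'm" by (simp add: vec_eq_iff)
    then show "(\<integral>\<^sup>+v. f (cis \<theta> *s (?r *\<^sub>R s + ?r *\<^sub>R v)) \<partial>complex_gaussian)
       = (\<integral>\<^sup>+v. f (cis \<theta> *s (?r *\<^sub>R s - ?r *\<^sub>R (\<i> *s v))) \<partial>complex_gaussian)"
      using nn_integral_complex_gaussian_times_ii[of "\<lambda>v. f (cis \<theta> *s (?r *\<^sub>R s - ?r *\<^sub>R (\<i> *s v)))"]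
      by simp
  qed
  also have "\<dots> = (\<integral>\<^sup>+s. \<integral>\<^sup>+v. f (?r *\<^sub>R (cos \<theta> *\<^sub>R s + sin \<theta> *\<^sub>R v) + ?r *\<^sub>R (\<i> *s (sin \<theta> *\<^sub>R s - cos \<theta> *\<^sub>R v))) \<partial>complex_gaussian \<partial>complex_gaussian)"
  proof -
    have "cis \<theta> *s (?r *\<^sub>R s - ?r *\<^sub>R (\<i> *s v)) =
      ?r *\<^sub>R (cos \<theta> *\<^sub>R s + sin \<theta> *\<^sub>R v) + ?r *\<^sub>R (\<i> *s (sin \<theta> *\<^sub>R s - cos \<theta> *\<^sub>R v))" for s v :: "complex ^ 'm"
      by (simp add: vec_eq_iff complex_eq_iff field_simps)
    then show ?thesis by simp
  qed
  also have "\<dots> = (\<integral>\<^sup>+s. \<integral>\<^sup>+v. f (?r *\<^sub>R s + ?r *\<^sub>R (\<i> *s v)) \<partial>complex_gaussian \<partial>complex_gaussian)"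
  proof -
    have "(\<lambda>z. f (?r *\<^sub>R fst z + ?r *\<^sub>R (\<i> *s snd z))) \<in> borel_measurable borel"
      by (simp add: borel_prod[symmetric])
    from complex_gaussian_pair_reflection[OF this, of "cos \<theta>" "sin \<theta>"] show ?thesis by simp
  qed
  also have "\<dots> = (\<integral>\<^sup>+s. \<integral>\<^sup>+v. f (?r *\<^sub>R s + ?r *\<^sub>R v) \<partial>complex_gaussian \<partial>complex_gaussian)"
    by (intro nn_integral_cong nn_integral_complex_gaussian_times_ii[of "\<lambda>v. f (?r *\<^sub>R _ + ?r *\<^sub>R v)"]) measurable
  also have "\<dots> = (\<integral>\<^sup>+x. f x \<partial>complex_gaussian)"
    by (rule complex_gaussian_pair_combine[OF _ r]) measurable
  finally show ?thesis .
qed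

section \<open>Gaussian means of entire functions\<close>

text \<open>
By phase invariance the Gaussian mean is an average over circles \<open>t \<mapsto> cis (2 * pi * t) *s v\<close>,
and on each of them the one-variable inequality applies.
\<close>

lemma complex_gaussian_mean_le_powr:
  fixes K :: "complex ^ 'm \<Rightarrow> complex"
  assumes [measurable]: "K \<in> borel_measurable borel"
    and holo: "\<And>v. (\<lambda>\<zeta>. K (\<zeta> *s v)) holomorphic_on UNIV" and "\<delta> > 0"
  shows "ennreal (norm (K 0) powr \<delta>) \<le> (\<integral>\<^sup>+v. ennreal (norm (K v) powr \<delta>) \<partial>complex_gaussian)"
proof -
  interpret G: prob_space "complex_gaussian :: (complex ^ 'm) measure"
    by (rule prob_space_complex_gaussian)
  interpret P: pair_sigma_finite "complex_gaussian :: (complex ^ 'm) measure" "lborel :: real measure" ..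
  define f where "f v = ennreal (norm (K v) powr \<delta>)" for v
  have [measurable]: "f \<in> borel_measurable borel" unfolding f_def by measurable
  have [measurable]: "(\<lambda>z :: (complex ^ 'm) \<times> real. cis (2 * pi * snd z) *s fst z) \<in> borel_measurable borel"
    by (intro borel_measurable_continuous_onI continuous_intros)
  then have [measurable]: "(\<lambda>z :: (complex ^ 'm) \<times> real. cis (2 * pi * snd z) *s fst z) \<in> borel_measurable (borel \<Otimes>\<^sub>M borel)"
    by (simp add: borel_prod)
  have "f 0 = (\<integral>\<^sup>+v. f 0 \<partial>(complex_gaussian :: (complex ^ 'm) measure))"
    using G.emeasure_space_1 by simp
  also have "\<dots> \<le> (\<integral>\<^sup>+v. (\<integral>\<^sup>+t. f (cis (2 * pi * t) *s v) * indicator {0..1} t \<partial>lborel) \<partial>complex_gaussian)"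
    using mean_value_le_powr_nn_integral[OF holo \<open>\<delta> > 0\<close>] by (intro nn_integral_mono) (simp add: f_def)
  also have "\<dots> = (\<integral>\<^sup>+t. (\<integral>\<^sup>+v. f (cis (2 * pi * t) *s v) * indicator {0..1} t \<partial>complex_gaussian) \<partial>lborel)"
    by (rule P.Fubini'[symmetric]) measurable
  also have "\<dots> = (\<integral>\<^sup>+t. (\<integral>\<^sup>+v. f v \<partial>complex_gaussian) * indicator {0..1} t \<partial>(lborel :: real measure))"
  proof (rule nn_integral_cong)
    fix t :: real
    have [measurable]: "(\<lambda>v :: complex ^ 'm. cis (2 * pi * t) *s v) \<in> borel_measurable borel"
      by (intro borel_measurable_continuous_onI continuous_intros)
    show "(\<integral>\<^sup>+v. f (cis (2 * pi * t) *s v) * indicator {0..1} t \<partial>complex_gaussian)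
       = (\<integral>\<^sup>+v. f v \<partial>complex_gaussian) * indicator {0..1} t"
      by (subst nn_integral_multc) (simp_all add: nn_integral_complex_gaussian_rotate)
  qed
  also have "\<dots> = (\<integral>\<^sup>+v. f v \<partial>complex_gaussian)"
    by (simp add: nn_integral_cmult_indicator)
  finally show ?thesis by (simp add: f_def)
qed

lemma product_prob_space_complex_gaussian:
  "product_prob_space (\<lambda>_ :: 'i. complex_gaussian :: (complex ^ 'm) measure)"
  by (intro product_prob_spaceI prob_space_complex_gaussian)

lemma nn_integral_complex_gaussian_PiM_sum:
  fixes f :: "complex ^ 'm \<Rightarrow> ennreal"
  assumes "finite I" and "f \<in> borel_measurable borel"
  shows "(\<integral>\<^sup>+x. f (\<Sum>i\<in>I. a i *\<^sub>R x i) \<partial>PiM I (\<lambda>_. complex_gaussian))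
    = (\<integral>\<^sup>+s. f (sqrt (\<Sum>i\<in>I. (a i)\<^sup>2) *\<^sub>R s) \<partial>complex_gaussian)"
  using assms
proof (induction I arbitrary: f rule: finite_induct)
  case empty
  interpret G: prob_space "complex_gaussian :: (complex ^ 'm) measure"
    by (rule prob_space_complex_gaussian)
  interpret product_prob_space "\<lambda>_ :: 'a. complex_gaussian :: (complex ^ 'm) measure"
    by (rule product_prob_space_complex_gaussian)
  show ?case
    using G.emeasure_space_1 by (simp add: PiM_empty nn_integral_count_space_finite)
next
  case (insert i I)
  interpret G: prob_space "complex_gaussian :: (complex ^ 'm) measure"
    by (rule prob_space_complex_gaussian)
  interpret product_prob_space "\<lambda>_ :: 'a. complex_gaussian :: (complex ^ 'm) measure"
    by (rule product_prob_space_complex_gaussian)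
  note [measurable] = insert.prems
  define b where "b = sqrt (\<Sum>i\<in>I. (a i)\<^sup>2)"
  define r where "r = sqrt (\<Sum>i\<in>insert i I. (a i)\<^sup>2)"
  have r2: "r\<^sup>2 = (a i)\<^sup>2 + b\<^sup>2"
    using insert.hyps by (simp add: r_def b_def sum_nonneg)
  have eq: "(\<Sum>j\<in>insert i I. a j *\<^sub>R (if j = i then y else x j)) = a i *\<^sub>R y + (\<Sum>j\<in>I. a j *\<^sub>R x j)"
    for x :: "'a \<Rightarrow> complex ^ 'm" and y
    using insert.hyps by (simp, intro sum.cong) auto
  have "(\<integral>\<^sup>+x. f (\<Sum>j\<in>insert i I. a j *\<^sub>R x j) \<partial>PiM (insert i I) (\<lambda>_. complex_gaussian))
    = (\<integral>\<^sup>+y. (\<integral>\<^sup>+x. f (a i *\<^sub>R y + (\<Sum>j\<in>I. a j *\<^sub>R x j)) \<partial>PiM I (\<lambda>_. complex_gaussian)) \<partial>complex_gaussian)"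
    by (subst product_nn_integral_insert_rev[OF insert.hyps]) (simp_all add: eq del: sum.insert)
  also have "\<dots> = (\<integral>\<^sup>+y. (\<integral>\<^sup>+s. f (a i *\<^sub>R y + b *\<^sub>R s) \<partial>complex_gaussian) \<partial>complex_gaussian)"
    unfolding b_def by (intro nn_integral_cong insert.IH) measurable
  also have "\<dots> = (\<integral>\<^sup>+s. f (r *\<^sub>R s) \<partial>complex_gaussian)"
  proof (cases "r = 0")
    case True
    then have "a i = 0" "b = 0" using r2 by (auto simp: add_nonneg_eq_0_iff)
    then show ?thesis using True G.emeasure_space_1 by simp
  next
    case False
    have "(\<integral>\<^sup>+y. (\<integral>\<^sup>+s. f (r *\<^sub>R ((a i / r) *\<^sub>R y + (b / r) *\<^sub>R s)) \<partial>complex_gaussian) \<partial>complex_gaussian)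
      = (\<integral>\<^sup>+s. f (r *\<^sub>R s) \<partial>complex_gaussian)"
      by (rule complex_gaussian_pair_combine)
         (use False r2 in \<open>auto simp: power_divide add_divide_distrib[symmetric]\<close>)
    then show ?thesis using False by (simp add: scaleR_add_right)
  qed
  finally show ?case unfolding r_def .
qed

text \<open>
Write a Gaussian tuple \<open>x\<close> with independent entries as \<open>(s / sqrt n, \<dots>, s / sqrt n) + v\<close>,
where \<open>s\<close> is the normalised sum of its entries, a standard Gaussian vector, and \<open>v\<close> is
independent of \<open>s\<close> and invariant under phases. For fixed \<open>s\<close> the subharmonicity of
\<open>norm G powr \<delta>\<close> allows us to replace \<open>v\<close> by \<open>0\<close>. The induction performs this one entry at a
time: the first \<open>n\<close> entries are already merged into one vector, which a plane reflection
combines with the last entry.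
\<close>

lemma complex_gaussian_PiM_diagonal_le:
  fixes G :: "(nat \<Rightarrow> complex ^ 'm) \<Rightarrow> complex"
  assumes "G \<in> borel_measurable (PiM {..<n} (\<lambda>_. borel))"
    and "\<And>a b. (\<lambda>\<zeta>. G (\<lambda>i. a i + \<zeta> *s b i)) holomorphic_on UNIV"
    and "\<And>x y. (\<And>i. i < n \<Longrightarrow> x i = y i) \<Longrightarrow> G x = G y"
    and "\<delta> > 0"
  shows "(\<integral>\<^sup>+s. ennreal (norm (G (\<lambda>_. (1 / sqrt n) *\<^sub>R s)) powr \<delta>) \<partial>complex_gaussian)
    \<le> (\<integral>\<^sup>+x. ennreal (norm (G x) powr \<delta>) \<partial>PiM {..<n} (\<lambda>_. complex_gaussian))"
  using assms(1-3)
proof (induction n arbitrary: G)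
  case 0
  interpret G: prob_space "complex_gaussian :: (complex ^ 'm) measure"
    by (rule prob_space_complex_gaussian)
  interpret product_prob_space "\<lambda>_ :: nat. complex_gaussian :: (complex ^ 'm) measure"
    by (rule product_prob_space_complex_gaussian)
  have "G (\<lambda>_. (1 / sqrt 0) *\<^sub>R s) = G (\<lambda>_. undefined)" for s
    by (rule 0(3)) simp
  then show ?case
    using G.emeasure_space_1 by (simp add: PiM_empty nn_integral_count_space_finite)
next
  case (Suc n)
  interpret product_prob_space "\<lambda>_ :: nat. complex_gaussian :: (complex ^ 'm) measure"
    by (rule product_prob_space_complex_gaussian)
  note [measurable] = Suc.prems(1)
  note holo = Suc.prems(2) and dep = Suc.prems(3)
  define f where "f x = ennreal (norm (G x) powr \<delta>)" for x
  have G' [measurable]: "G \<in> borel_measurable (PiM (insert n {..<n}) (\<lambda>_. borel))"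
    using Suc.prems(1) by (simp add: lessThan_Suc)
  have f [measurable]: "f \<in> borel_measurable (PiM (insert n {..<n}) (\<lambda>_. borel))"
    unfolding f_def by measurable
  \<comment> \<open>With \<open>y = c s + d v\<close> for the last entry and \<open>d s - c v\<close> for the merged vector, the choice
    \<open>v = 0\<close> puts \<open>s / sqrt (n + 1)\<close> in every entry. For \<open>n = 0\<close> this is \<open>d = 0\<close>.\<close>
  define c where "c = 1 / sqrt (Suc n)"
  define d where "d = sqrt n / sqrt (Suc n)"
  have cd: "c\<^sup>2 + d\<^sup>2 = 1"
    by (simp add: c_def d_def power_divide add_divide_distrib[symmetric] add_nonneg_eq_0_iff)
  define H where "H z = f ((\<lambda>_. (1 / sqrt n) *\<^sub>R snd z)(n := fst z))" for z :: "(complex ^ 'm) \<times> (complex ^ 'm)"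
  have H: "H \<in> borel_measurable borel"
  proof -
    have "H z = f (\<lambda>i\<in>insert n {..<n}. if i = n then fst z else (1 / sqrt n) *\<^sub>R snd z)" for z
      unfolding H_def f_def by (rule arg_cong[where f = "\<lambda>w. ennreal (norm w powr \<delta>)"], rule dep) auto
    then have "H \<in> borel_measurable (borel \<Otimes>\<^sub>M borel)"
      by (simp cong: measurable_cong) measurable
    then show ?thesis by (simp add: borel_prod)
  qed
  have "(\<integral>\<^sup>+s. f (\<lambda>_. c *\<^sub>R s) \<partial>complex_gaussian)
     \<le> (\<integral>\<^sup>+s. \<integral>\<^sup>+v. H (c *\<^sub>R s + d *\<^sub>R v, d *\<^sub>R s - c *\<^sub>R v) \<partial>complex_gaussian \<partial>complex_gaussian)"
  proof (rule nn_integral_mono)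
    fix s :: "complex ^ 'm"
    define K where "K v = G ((\<lambda>_. (1 / sqrt n) *\<^sub>R (d *\<^sub>R s - c *\<^sub>R v))(n := c *\<^sub>R s + d *\<^sub>R v))" for v
    have "f (\<lambda>_. c *\<^sub>R s) = ennreal (norm (K 0) powr \<delta>)"
      unfolding f_def K_def
      by (rule arg_cong[where f = "\<lambda>w. ennreal (norm w powr \<delta>)"], rule dep) (auto simp: c_def d_def)
    also have "\<dots> \<le> (\<integral>\<^sup>+v. ennreal (norm (K v) powr \<delta>) \<partial>complex_gaussian)"
    proof (rule complex_gaussian_mean_le_powr[OF _ _ \<open>\<delta> > 0\<close>])
      have "K v = G (\<lambda>i\<in>insert n {..<n}. if i = n then c *\<^sub>R s + d *\<^sub>R v else (1 / sqrt n) *\<^sub>R (d *\<^sub>R s - c *\<^sub>R v))" for v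
        unfolding K_def by (rule dep) auto
      then show "K \<in> borel_measurable borel"
        by (simp cong: measurable_cong) measurable
      fix v
      have "K (\<zeta> *s v) = G (\<lambda>i. (if i = n then c *\<^sub>R s else (1 / sqrt n) *\<^sub>R d *\<^sub>R s)
            + \<zeta> *s (if i = n then d *\<^sub>R v else - (1 / sqrt n) *\<^sub>R c *\<^sub>R v))" for \<zeta>
        unfolding K_def by (rule dep) (auto simp: vec_eq_iff scaleR_conv_of_real algebra_simps)
      then show "(\<lambda>\<zeta>. K (\<zeta> *s v)) holomorphic_on UNIV"
        by (simp add: holo)
    qed
    also have "\<dots> = (\<integral>\<^sup>+v. H (c *\<^sub>R s + d *\<^sub>R v, d *\<^sub>R s - c *\<^sub>R v) \<partial>complex_gaussian)"
      by (simp add: H_def K_def f_def)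
    finally show "f (\<lambda>_. c *\<^sub>R s) \<le> (\<integral>\<^sup>+v. H (c *\<^sub>R s + d *\<^sub>R v, d *\<^sub>R s - c *\<^sub>R v) \<partial>complex_gaussian)" .
  qed
  also have "\<dots> = (\<integral>\<^sup>+y. \<integral>\<^sup>+s. f ((\<lambda>_. (1 / sqrt n) *\<^sub>R s)(n := y)) \<partial>complex_gaussian \<partial>complex_gaussian)"
    by (subst complex_gaussian_pair_reflection[OF H cd, symmetric]) (simp add: H_def)
  also have "\<dots> \<le> (\<integral>\<^sup>+y. \<integral>\<^sup>+x. f (x(n := y)) \<partial>PiM {..<n} (\<lambda>_. complex_gaussian) \<partial>complex_gaussian)"
  proof (rule nn_integral_mono)
    fix y :: "complex ^ 'm"
    show "(\<integral>\<^sup>+s. f ((\<lambda>_. (1 / sqrt n) *\<^sub>R s)(n := y)) \<partial>complex_gaussian)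
       \<le> (\<integral>\<^sup>+x. f (x(n := y)) \<partial>PiM {..<n} (\<lambda>_. complex_gaussian))"
      unfolding f_def
    proof (rule Suc.IH)
      show "(\<lambda>x. G (x(n := y))) \<in> borel_measurable (PiM {..<n} (\<lambda>_. borel))"
        by measurable
      show "(\<lambda>\<zeta>. G ((\<lambda>i. a i + \<zeta> *s b i)(n := y))) holomorphic_on UNIV" for a b
      proof -
        have "(\<lambda>i. a i + \<zeta> *s b i)(n := y) = (\<lambda>i. (a(n := y)) i + \<zeta> *s (b(n := 0)) i)" for \<zeta>
          by (auto simp: fun_eq_iff)
        then show ?thesis by (simp only: holo)
      qed
      show "G (x(n := y)) = G (x'(n := y))" if "\<And>i. i < n \<Longrightarrow> x i = x' i" for x x'
        by (rule dep) (use that in auto)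
    qed
  qed
  also have "\<dots> = (\<integral>\<^sup>+x. f x \<partial>PiM {..<Suc n} (\<lambda>_. complex_gaussian))"
    unfolding lessThan_Suc by (rule product_nn_integral_insert_rev[symmetric]) (simp_all cong: measurable_cong_sets sets_PiM_cong)
  finally show ?case unfolding f_def c_def .
qed

section \<open>Finner's inequality\<close>

text \<open>
The inequality of arithmetic and geometric means, freed of roots and divisions so that infinite
values are admitted.
\<close>

lemma ennreal_prod_power_le_sum:
  fixes x :: "'a \<Rightarrow> ennreal"
  assumes "finite J" "J \<noteq> {}"
  shows "of_nat (card J) * (\<Prod>j\<in>J. x j) \<le> (\<Sum>j\<in>J. x j ^ card J)"
proof (cases "\<exists>j\<in>J. x j = top")
  case True
  then have "(\<Sum>j\<in>J. x j ^ card J) = top"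
    using assms by (auto simp: power_eq_top_ennreal card_gt_0_iff)
  then show ?thesis by simp
next
  case False
  define r where "r j = enn2real (x j)" for j
  have r: "\<And>j. j \<in> J \<Longrightarrow> x j = ennreal (r j)" "\<And>j. r j \<ge> 0"
    using False by (auto simp: r_def less_top)
  let ?k = "card J"
  have k: "?k > 0" using assms by (simp add: card_gt_0_iff)
  have "(\<Prod>j\<in>J. r j ^ ?k) powr (1 / ?k) \<le> (\<Sum>j\<in>J. r j ^ ?k / ?k)"
    by (rule arith_geom_mean) (use assms r in auto)
  also have "(\<Prod>j\<in>J. r j ^ ?k) powr (1 / ?k) = root ?k ((\<Prod>j\<in>J. r j) ^ ?k)"
    using k r(2) by (subst root_powr_inverse) (simp_all add: prod_power_distrib prod_nonneg)
  also have "\<dots> = (\<Prod>j\<in>J. r j)"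
    using k r(2) by (simp add: real_root_power_cancel prod_nonneg)
  finally have "real ?k * (\<Prod>j\<in>J. r j) \<le> (\<Sum>j\<in>J. r j ^ ?k)"
    using k by (simp add: sum_divide_distrib[symmetric] field_simps)
  then have "ennreal (real ?k * (\<Prod>j\<in>J. r j)) \<le> ennreal (\<Sum>j\<in>J. r j ^ ?k)"
    by (rule ennreal_leI)
  moreover have "(\<Prod>j\<in>J. x j) = ennreal (\<Prod>j\<in>J. r j)"
    using r by (simp add: prod_ennreal)
  moreover have "(\<Sum>j\<in>J. x j ^ ?k) = ennreal (\<Sum>j\<in>J. r j ^ ?k)"
    using r by (simp add: ennreal_power)
  ultimately show ?thesis
    by (simp add: ennreal_mult' ennreal_of_nat_eq_real_of_nat)
qed

lemma ennreal_power_le_cancel: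
  fixes a b :: ennreal
  assumes "a ^ k \<le> b ^ k" "k > 0"
  shows "a \<le> b"
proof (cases "b = top")
  case b: False
  then have "b ^ k \<noteq> top" by (simp add: power_eq_top_ennreal)
  then have "a \<noteq> top"
    using assms by (metis neq_top_trans power_top_ennreal)
  then obtain r s where "a = ennreal r" "b = ennreal s" "r \<ge> 0" "s \<ge> 0"
    using b by (metis ennreal_cases)
  then show ?thesis
    using assms by (simp add: ennreal_power)
qed simp

text \<open>
  A root on the extended nonnegative reals: the partial norms in the induction for Finner's
  inequality may be infinite.
\<close>

definition ennroot :: "nat \<Rightarrow> ennreal \<Rightarrow> ennreal" where
  "ennroot k x = (if x = top then top else ennreal (root k (enn2real x)))"

lemma ennroot_power [simp]: "k > 0 \<Longrightarrow> ennroot k x ^ k = x"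
  by (auto simp: ennroot_def ennreal_power ennreal_enn2real_if power_eq_top_ennreal)

lemma measurable_ennroot [measurable]:
  assumes [measurable]: "f \<in> borel_measurable M"
  shows "(\<lambda>x. ennroot k (f x)) \<in> borel_measurable M"
proof -
  have [measurable]: "root k \<in> borel_measurable borel"
    by (intro borel_measurable_continuous_onI continuous_intros)
  show ?thesis unfolding ennroot_def by measurable
qed

text \<open>
Hoelder's inequality for \<open>card J\<close> functions with equal exponents. When all factors have finite
nonzero norms \<open>c j\<close>, the inequality of means is integrated for the normalised functions.
\<close>

lemma nn_integral_prod_Holder:
  fixes h :: "'j \<Rightarrow> 'a \<Rightarrow> ennreal"
  assumes J: "finite J" "J \<noteq> {}" and [measurable]: "\<And>j. j \<in> J \<Longrightarrow> h j \<in> borel_measurable M"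
  shows "(\<integral>\<^sup>+x. (\<Prod>j\<in>J. h j x) \<partial>M) ^ card J \<le> (\<Prod>j\<in>J. \<integral>\<^sup>+x. h j x ^ card J \<partial>M)"
proof -
  let ?k = "card J"
  have k: "?k > 0" using J by (simp add: card_gt_0_iff)
  define A where "A j = (\<integral>\<^sup>+x. h j x ^ ?k \<partial>M)" for j
  consider (zero) j where "j \<in> J" "A j = 0" | (top) j where "j \<in> J" "A j = top" "\<forall>i\<in>J. A i \<noteq> 0"
    | (fin) "\<forall>j\<in>J. A j \<noteq> 0 \<and> A j \<noteq> top" by blast
  then have "(\<integral>\<^sup>+x. (\<Prod>j\<in>J. h j x) \<partial>M) ^ ?k \<le> (\<Prod>j\<in>J. A j)"
  proof cases
    case zero
    then have "AE x in M. h j x ^ ?k = 0"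
      unfolding A_def by (subst (asm) nn_integral_0_iff_AE) measurable
    then have "AE x in M. (\<Prod>j\<in>J. h j x) = 0"
      by eventually_elim (use J zero in auto)
    then have "(\<integral>\<^sup>+x. (\<Prod>j\<in>J. h j x) \<partial>M) = 0"
      by (subst nn_integral_0_iff_AE) measurable
    then show ?thesis using k by (simp add: zero_power)
  next
    case top
    then have "(\<Prod>j\<in>J. A j) = top"
      using J by (auto simp: ennreal_prod_eq_top)
    then show ?thesis by simp
  next
    case fin
    define c where "c j = ennroot ?k (A j)" for j
    have ck: "c j ^ ?k = A j" for j using k by (simp add: c_def)
    have c: "c j \<noteq> 0" "c j \<noteq> top" if "j \<in> J" for j
      using fin that ck[of j] k by (auto simp: zero_power)
    define C where "C = (\<Prod>j\<in>J. c j)"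
    have C: "C \<noteq> 0" "C \<noteq> top"
      using c J by (auto simp: C_def ennreal_prod_eq_top)
    have "of_nat ?k * (\<integral>\<^sup>+x. (\<Prod>j\<in>J. h j x / c j) \<partial>M) = (\<integral>\<^sup>+x. of_nat ?k * (\<Prod>j\<in>J. h j x / c j) \<partial>M)"
      by (rule nn_integral_cmult[symmetric]) measurable
    also have "\<dots> \<le> (\<integral>\<^sup>+x. (\<Sum>j\<in>J. (h j x / c j) ^ ?k) \<partial>M)"
      by (intro nn_integral_mono ennreal_prod_power_le_sum J)
    also have "\<dots> = (\<Sum>j\<in>J. \<integral>\<^sup>+x. (h j x / c j) ^ ?k \<partial>M)"
      by (rule nn_integral_sum) measurable
    also have "\<dots> = (\<Sum>j\<in>J. 1)"
    proof (rule sum.cong[OF refl])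
      fix j assume j: "j \<in> J"
      have "(\<integral>\<^sup>+x. (h j x / c j) ^ ?k \<partial>M) = (\<integral>\<^sup>+x. h j x ^ ?k / A j \<partial>M)"
        using c[OF j] by (simp add: ck[symmetric] divide_ennreal_def power_mult_distrib ennreal_inverse_power)
      also have "\<dots> = A j / A j"
        using j by (simp add: nn_integral_divide A_def)
      also have "\<dots> = 1" using fin j by (simp add: ennreal_divide_self top.not_eq_extremum)
      finally show "(\<integral>\<^sup>+x. (h j x / c j) ^ ?k \<partial>M) = 1" .
    qed
    finally have "of_nat ?k * (\<integral>\<^sup>+x. (\<Prod>j\<in>J. h j x / c j) \<partial>M) \<le> of_nat ?k * 1"
      by simp
    then have le1: "(\<integral>\<^sup>+x. (\<Prod>j\<in>J. h j x / c j) \<partial>M) \<le> 1"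
      using k by (subst (asm) ennreal_mult_le_mult_iff) auto
    have "(\<Prod>j\<in>J. h j x) = C * (\<Prod>j\<in>J. h j x / c j)" for x
    proof -
      have "h j x = c j * (h j x / c j)" if "j \<in> J" for j
        using c[OF that] by (simp add: ennreal_times_divide mult_divide_eq_ennreal mult.commute[of "c j"])
      then have "(\<Prod>j\<in>J. h j x) = (\<Prod>j\<in>J. c j * (h j x / c j))" by (rule prod.cong[OF refl])
      then show ?thesis by (simp add: C_def prod.distrib)
    qed
    then have "(\<integral>\<^sup>+x. (\<Prod>j\<in>J. h j x) \<partial>M) = C * (\<integral>\<^sup>+x. (\<Prod>j\<in>J. h j x / c j) \<partial>M)"
      by (simp add: nn_integral_cmult)
    also have "\<dots> \<le> C" using mult_left_mono[OF le1, of C] by simp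
    finally have "(\<integral>\<^sup>+x. (\<Prod>j\<in>J. h j x) \<partial>M) ^ ?k \<le> C ^ ?k"
      by (rule power_mono_ennreal)
    also have "C ^ ?k = (\<Prod>j\<in>J. A j)"
      by (simp add: C_def prod_power_distrib ck)
    finally show ?thesis .
  qed
  then show ?thesis by (simp add: A_def)
qed

text \<open>
Finner's generalisation of the Loomis--Whitney inequality. Coordinates are integrated out one
after the other. Exactly \<open>k\<close> of the functions depend on the coordinate \<open>i\<close>, so Hoelder's
inequality with exponent \<open>k\<close> applies to them; each is replaced by its \<open>L\<^sup>k\<close>-norm in the
coordinate \<open>i\<close>, and the covering hypothesis survives for the other coordinates.
\<close>

lemma nn_integral_PiM_Finner:
  fixes h :: "'j \<Rightarrow> ('i \<Rightarrow> 'a) \<Rightarrow> ennreal" and M :: "'a measure"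
  assumes M: "prob_space M" and "finite J" "k > 0" "finite I"
    and "\<And>i. i \<in> I \<Longrightarrow> card {j \<in> J. i \<in> S j} = k"
    and "\<And>j. j \<in> J \<Longrightarrow> h j \<in> borel_measurable (PiM I (\<lambda>_. M))"
    and "\<And>j x y. j \<in> J \<Longrightarrow> (\<And>i. i \<in> S j \<Longrightarrow> x i = y i) \<Longrightarrow> h j x = h j y"
  shows "(\<integral>\<^sup>+x. (\<Prod>j\<in>J. h j x) \<partial>PiM I (\<lambda>_. M)) ^ k \<le> (\<Prod>j\<in>J. \<integral>\<^sup>+x. h j x ^ k \<partial>PiM I (\<lambda>_. M))"
  using assms(4-7)
proof (induction I arbitrary: h S rule: finite_induct)
  case empty
  show ?case by (simp add: PiM_empty nn_integral_count_space_finite prod_power_distrib)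
next
  case (insert i I)
  interpret M: prob_space M by (rule M)
  interpret product_prob_space "\<lambda>_ :: 'i. M" by (rule product_prob_spaceI) (rule M)
  note dep = insert.prems(3)
  note [measurable] = insert.prems(2)
  define J1 where "J1 = {j \<in> J. i \<in> S j}"
  have cardJ1: "card J1 = k"
    using insert.prems(1)[of i] by (simp add: J1_def)
  then have "J1 \<noteq> {}" using \<open>k > 0\<close> by auto
  then have J1: "finite J1" "J1 \<noteq> {}" "J1 \<subseteq> J"
    using \<open>finite J\<close> by (auto simp: J1_def)
  define h' where "h' j x = (if j \<in> J1 then ennroot k (\<integral>\<^sup>+y. h j (x(i := y)) ^ k \<partial>M) else h j x)" for j x
  have const: "h j (x(i := y)) = h j x" if "j \<in> J - J1" for j x y
    by (rule dep) (use that in \<open>auto simp: J1_def\<close>)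
  obtain y0 where y0: "y0 \<in> space M" using M.not_empty by blast
  have meas: "h' j \<in> borel_measurable (PiM I (\<lambda>_. M))" if [measurable]: "j \<in> J" for j
  proof (cases "j \<in> J1")
    case True
    then show ?thesis unfolding h'_def using insert.hyps by simp
  next
    case False
    have "(\<lambda>x. h j (x(i := y0))) \<in> borel_measurable (PiM I (\<lambda>_. M))"
      using y0 by measurable
    moreover have "h' j = (\<lambda>x. h j (x(i := y0)))"
      using False const[of j] that by (auto simp: h'_def fun_eq_iff)
    ultimately show ?thesis by simp
  qed
  have int: "(\<integral>\<^sup>+x. h' j x ^ k \<partial>PiM I (\<lambda>_. M)) = (\<integral>\<^sup>+x. h j x ^ k \<partial>PiM (insert i I) (\<lambda>_. M))" if [measurable]: "j \<in> J" for j
  proof -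
    have "h' j x ^ k = (\<integral>\<^sup>+y. h j (x(i := y)) ^ k \<partial>M)" for x
      using const[of j] that \<open>k > 0\<close> M.emeasure_space_1 by (auto simp: h'_def)
    then show ?thesis
      by (subst product_nn_integral_insert[OF insert.hyps]) simp_all
  qed
  have "(\<integral>\<^sup>+x. (\<Prod>j\<in>J. h j x) \<partial>PiM (insert i I) (\<lambda>_. M))
      = (\<integral>\<^sup>+x. (\<integral>\<^sup>+y. (\<Prod>j\<in>J. h j (x(i := y))) \<partial>M) \<partial>PiM I (\<lambda>_. M))"
    by (rule product_nn_integral_insert[OF insert.hyps]) measurable
  also have "\<dots> \<le> (\<integral>\<^sup>+x. (\<Prod>j\<in>J. h' j x) \<partial>PiM I (\<lambda>_. M))"
  proof (rule nn_integral_mono)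
    fix x assume x [measurable]: "x \<in> space (PiM I (\<lambda>_. M))"
    have [measurable]: "(\<lambda>y. h j (x(i := y))) \<in> borel_measurable M" if [measurable]: "j \<in> J" for j
      by measurable
    have split: "(\<Prod>j\<in>J. f j) = (\<Prod>j\<in>J - J1. f j) * (\<Prod>j\<in>J1. f j)" for f :: "'j \<Rightarrow> ennreal"
      using prod.subset_diff[OF J1(3) \<open>finite J\<close>] by blast
    have "(\<integral>\<^sup>+y. (\<Prod>j\<in>J1. h j (x(i := y))) \<partial>M) \<le> (\<Prod>j\<in>J1. h' j x)"
    proof (rule ennreal_power_le_cancel[OF _ \<open>k > 0\<close>])
      have "(\<integral>\<^sup>+y. (\<Prod>j\<in>J1. h j (x(i := y))) \<partial>M) ^ k \<le> (\<Prod>j\<in>J1. \<integral>\<^sup>+y. h j (x(i := y)) ^ k \<partial>M)"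
        using nn_integral_prod_Holder[OF J1(1,2), of "\<lambda>j y. h j (x(i := y))" M] J1(3) cardJ1
        by (simp add: subset_iff)
      also have "\<dots> = (\<Prod>j\<in>J1. h' j x) ^ k"
        using \<open>k > 0\<close> by (simp add: h'_def prod_power_distrib)
      finally show "(\<integral>\<^sup>+y. (\<Prod>j\<in>J1. h j (x(i := y))) \<partial>M) ^ k \<le> (\<Prod>j\<in>J1. h' j x) ^ k" .
    qed
    moreover have "(\<integral>\<^sup>+y. (\<Prod>j\<in>J. h j (x(i := y))) \<partial>M)
       = (\<Prod>j\<in>J - J1. h' j x) * (\<integral>\<^sup>+y. (\<Prod>j\<in>J1. h j (x(i := y))) \<partial>M)"
    proof -
      have "(\<Prod>j\<in>J. h j (x(i := y))) = (\<Prod>j\<in>J - J1. h' j x) * (\<Prod>j\<in>J1. h j (x(i := y)))" for y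
        unfolding split by (rule arg_cong2[where f = "(*)"], rule prod.cong) (auto simp: const h'_def)
      then show ?thesis using J1(3) by (simp add: nn_integral_cmult subset_iff)
    qed
    ultimately show "(\<integral>\<^sup>+y. (\<Prod>j\<in>J. h j (x(i := y))) \<partial>M) \<le> (\<Prod>j\<in>J. h' j x)"
      unfolding split[of "\<lambda>j. h' j x"] by (simp add: mult_left_mono)
  qed
  finally have "(\<integral>\<^sup>+x. (\<Prod>j\<in>J. h j x) \<partial>PiM (insert i I) (\<lambda>_. M)) ^ k
      \<le> (\<integral>\<^sup>+x. (\<Prod>j\<in>J. h' j x) \<partial>PiM I (\<lambda>_. M)) ^ k"
    by (rule power_mono_ennreal)
  also have "\<dots> \<le> (\<Prod>j\<in>J. \<integral>\<^sup>+x. h' j x ^ k \<partial>PiM I (\<lambda>_. M))"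
  proof (rule insert.IH)
    show "card {j \<in> J. i' \<in> S j - {i}} = k" if "i' \<in> I" for i'
    proof -
      have "{j \<in> J. i' \<in> S j - {i}} = {j \<in> J. i' \<in> S j}" using that insert.hyps by auto
      then show ?thesis using insert.prems(1)[of i'] that by simp
    qed
    show "h' j x = h' j y" if j: "j \<in> J" and eq: "\<And>i'. i' \<in> S j - {i} \<Longrightarrow> x i' = y i'" for j x y
    proof -
      have "h j (x(i := z)) = h j (y(i := z))" for z
        by (rule dep[OF j]) (use eq in auto)
      moreover have "h j x = h j y" if "j \<notin> J1"
        by (rule dep[OF j]) (use eq that j in \<open>auto simp: J1_def\<close>)
      ultimately show ?thesis by (simp add: h'_def)
    qed
  qed (rule meas)
  also have "\<dots> = (\<Prod>j\<in>J. \<integral>\<^sup>+x. h j x ^ k \<partial>PiM (insert i I) (\<lambda>_. M))"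
    by (intro prod.cong refl int)
  finally show ?case .
qed

section \<open>Hypercontractivity\<close>

lemma entire_cn_continuous_on: "entire_cn F \<Longrightarrow> continuous_on S F"
  unfolding entire_cn_def
  by (meson continuous_at_imp_continuous_on has_derivative_continuous)

lemma entire_cn_holomorphic_on_line:
  fixes F :: "complex ^ 'm \<Rightarrow> complex"
  assumes "entire_cn F"
  shows "(\<lambda>\<zeta>. F (u + \<zeta> *s v)) holomorphic_on UNIV"
proof -
  have "(\<lambda>\<zeta>. F (u + \<zeta> *s v)) field_differentiable at \<zeta>" for \<zeta>
  proof -
    obtain D where D: "(F has_derivative D) (at (u + \<zeta> *s v))" "\<And>c v. D (c *s v) = c * D v"
      using assms unfolding entire_cn_def by blast
    have "bounded_linear (\<lambda>h :: complex. h *s v)"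
      by (rule linear_conv_bounded_linear[THEN iffD1])
         (auto intro!: linearI simp: vec_eq_iff algebra_simps)
    then have "((\<lambda>\<zeta>. \<zeta> *s v) has_derivative (\<lambda>h. h *s v)) (at \<zeta>)"
      by (rule bounded_linear_imp_has_derivative)
    then have "((\<lambda>\<zeta>. u + \<zeta> *s v) has_derivative (\<lambda>h. h *s v)) (at \<zeta>)"
      using has_derivative_add[OF has_derivative_const] by fastforce
    from has_derivative_compose[OF this D(1)]
    have "((\<lambda>\<zeta>. F (u + \<zeta> *s v)) has_derivative (*) (D v)) (at \<zeta>)"
      by (simp add: D(2) mult.commute[of _ "D v"])
    then show ?thesis
      unfolding field_differentiable_def has_field_derivative_def by blast
  qed
  then show ?thesis
    by (simp add: holomorphic_on_def)
qed

text \<open>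
Used as the covering multiplicity of the family of all \<open>k\<close>-element subsets.
\<close>

lemma card_subsets_containing:
  assumes "finite A" "i \<in> A" "k > 0"
  shows "card {S. S \<subseteq> A \<and> card S = k \<and> i \<in> S} = (card A - 1) choose (k - 1)"
proof -
  have "{S. S \<subseteq> A \<and> card S = k \<and> i \<in> S} = insert i ` {T. T \<subseteq> A - {i} \<and> card T = k - 1}"
  proof (intro set_eqI iffI)
    fix S assume S: "S \<in> {S. S \<subseteq> A \<and> card S = k \<and> i \<in> S}"
    then have "finite S" using assms finite_subset by blast
    with S show "S \<in> insert i ` {T. T \<subseteq> A - {i} \<and> card T = k - 1}"
      by (intro image_eqI[of _ _ "S - {i}"]) auto
  next
    fix S assume "S \<in> insert i ` {T. T \<subseteq> A - {i} \<and> card T = k - 1}"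
    then obtain T where T: "S = insert i T" "T \<subseteq> A - {i}" "card T = k - 1" by blast
    then have "finite T" "i \<notin> T" using assms finite_subset by blast+
    with T assms show "S \<in> {S. S \<subseteq> A \<and> card S = k \<and> i \<in> S}" by auto
  qed
  moreover have "inj_on (insert i) {T. T \<subseteq> A - {i} \<and> card T = k - 1}"
    by (auto simp: inj_on_def)
  ultimately show ?thesis
    using assms by (simp add: card_image n_subsets)
qed

lemma power_powr: "(a ^ N) powr \<delta> = a powr (real N * \<delta>)" if "a \<ge> 0" "N > 0" for a \<delta> :: real
  using that by (simp add: powr_realpow'[symmetric] powr_powr)

lemma powr_power_nonneg: "(a powr \<delta>) ^ N = a powr (real N * \<delta>)" if "N > 0" for a \<delta> :: real
  using that by (cases "a = 0") (simp_all add: powr_power)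

text \<open>
The heart of the proof, for the ratio \<open>k / n\<close>. Let \<open>s S\<close> be the normalised sum of the Gaussian
vectors indexed by \<open>S\<close>, and let \<open>S\<close> range over the \<open>k\<close>-element subsets of \<open>{..<n}\<close>. The function
\<open>G = (\<Prod>S. F (s S))\<close> is entire on the tuples. On the diagonal all \<open>s S\<close> coincide with
\<open>sqrt (k / n)\<close> times the normalised total sum, so the diagonal estimate bounds the left-hand side
by the mean of \<open>norm G powr (p / K)\<close>. Each index lies in exactly \<open>K\<close> of the subsets, so Finner's
inequality separates the factors, and every \<open>s S\<close> is itself a standard Gaussian vector.
\<close>

lemma hypercontractive_rational_powers:
  fixes F :: "complex ^ 'm \<Rightarrow> complex"
  assumes F: "entire_cn F" and "0 < p" and "0 < k" "k \<le> n"
  defines "K \<equiv> (n - 1) choose (k - 1)"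
  shows "(\<integral>\<^sup>+s. ennreal (norm (F (sqrt (real k / real n) *\<^sub>R s)) powr (real n * p / real k)) \<partial>complex_gaussian) ^ K
    \<le> (\<integral>\<^sup>+s. ennreal (norm (F s) powr p) \<partial>complex_gaussian) ^ (n choose k)"
proof -
  interpret product_prob_space "\<lambda>_ :: nat. complex_gaussian :: (complex ^ 'm) measure"
    by (rule product_prob_space_complex_gaussian)
  have [measurable]: "F \<in> borel_measurable borel"
    by (intro borel_measurable_continuous_onI entire_cn_continuous_on F)
  have K: "K > 0" using \<open>k > 0\<close> \<open>k \<le> n\<close> by (simp add: K_def)
  have NK: "real (n choose k) * real k = real n * real K"
    using times_binomial_minus1_eq[OF \<open>k > 0\<close>, of n] unfolding K_def
    by (metis mult.commute of_nat_mult)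
  define J where "J = {S. S \<subseteq> {..<n} \<and> card S = k}"
  have finJ: "finite J" unfolding J_def by (rule finite_subset[of _ "Pow {..<n}"]) auto
  have cardJ: "card J = n choose k" by (simp add: J_def n_subsets)
  define s where "s S x = (\<Sum>i<n. (if i \<in> S then 1 / sqrt k else 0) *\<^sub>R x i)"
    for S and x :: "nat \<Rightarrow> complex ^ 'm"
  \<comment> \<open>The \<open>K\<close>-th power in Finner's inequality then turns \<open>norm F powr \<delta>\<close> into \<open>norm F powr p\<close>.\<close>
  define \<delta> where "\<delta> = p / K"
  have \<delta>: "\<delta> > 0" using K \<open>p > 0\<close> by (simp add: \<delta>_def)
  define G where "G x = (\<Prod>S\<in>J. F (s S x))" for x
  define h where "h S x = ennreal (norm (F (s S x)) powr \<delta>)" for S x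
  have norm_G: "ennreal (norm (G x) powr \<delta>) = (\<Prod>S\<in>J. h S x)" for x
    by (simp add: G_def h_def prod_norm[symmetric] prod_powr_distrib prod_ennreal)
  have s_diag: "s S (\<lambda>_. (1 / sqrt n) *\<^sub>R z) = sqrt (real k / real n) *\<^sub>R z" if "S \<in> J" for S z
  proof -
    have "s S (\<lambda>_. (1 / sqrt n) *\<^sub>R z) = (\<Sum>i\<in>S. (1 / sqrt k) *\<^sub>R (1 / sqrt n) *\<^sub>R z)"
      unfolding s_def using that by (intro sum.mono_neutral_cong_right) (auto simp: J_def)
    also have "\<dots> = (real k / sqrt k / sqrt n) *\<^sub>R z"
      using that by (simp add: J_def sum_constant_scaleR del: sum_constant)
    also have "real k / sqrt k / sqrt n = sqrt (real k / real n)"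
      by (simp add: real_div_sqrt real_sqrt_divide)
    finally show ?thesis .
  qed
  have "(\<integral>\<^sup>+z. ennreal (norm (F (sqrt (real k / real n) *\<^sub>R z)) powr (real n * p / real k)) \<partial>complex_gaussian)
      = (\<integral>\<^sup>+z. ennreal (norm (G (\<lambda>_. (1 / sqrt n) *\<^sub>R z)) powr \<delta>) \<partial>complex_gaussian)"
  proof (rule nn_integral_cong)
    fix z
    have "norm (G (\<lambda>_. (1 / sqrt n) *\<^sub>R z)) = norm (F (sqrt (real k / real n) *\<^sub>R z)) ^ (n choose k)"
      by (simp add: G_def s_diag cardJ norm_power)
    moreover have "real (n choose k) * \<delta> = real n * p / real k"
      using NK K \<open>k > 0\<close> by (simp add: \<delta>_def field_simps)
    ultimately show "ennreal (norm (F (sqrt (real k / real n) *\<^sub>R z)) powr (real n * p / real k))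
      = ennreal (norm (G (\<lambda>_. (1 / sqrt n) *\<^sub>R z)) powr \<delta>)"
      using \<open>k \<le> n\<close> by (simp add: power_powr)
  qed
  also have "\<dots> \<le> (\<integral>\<^sup>+x. ennreal (norm (G x) powr \<delta>) \<partial>PiM {..<n} (\<lambda>_. complex_gaussian))"
  proof (rule complex_gaussian_PiM_diagonal_le[OF _ _ _ \<delta>])
    show "G \<in> borel_measurable (PiM {..<n} (\<lambda>_. borel))"
      unfolding G_def s_def by measurable
    have "s S (\<lambda>i. a i + \<zeta> *s b i) = s S a + \<zeta> *s s S b" for S \<zeta> a b
      by (simp add: s_def vec_eq_iff sum.distrib sum_distrib_left scaleR_conv_of_real algebra_simps)
    then show "(\<lambda>\<zeta>. G (\<lambda>i. a i + \<zeta> *s b i)) holomorphic_on UNIV" for a b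
      unfolding G_def by (auto intro!: holomorphic_intros entire_cn_holomorphic_on_line F)
    show "G x = G y" if "\<And>i. i < n \<Longrightarrow> x i = y i" for x y
      using that by (simp add: G_def s_def)
  qed
  also have "\<dots> = (\<integral>\<^sup>+x. (\<Prod>S\<in>J. h S x) \<partial>PiM {..<n} (\<lambda>_. complex_gaussian))"
    by (simp add: norm_G)
  finally have "(\<integral>\<^sup>+z. ennreal (norm (F (sqrt (real k / real n) *\<^sub>R z)) powr (real n * p / real k)) \<partial>complex_gaussian) ^ K
      \<le> (\<integral>\<^sup>+x. (\<Prod>S\<in>J. h S x) \<partial>PiM {..<n} (\<lambda>_. complex_gaussian)) ^ K"
    by (rule power_mono_ennreal)
  also have "\<dots> \<le> (\<Prod>S\<in>J. \<integral>\<^sup>+x. h S x ^ K \<partial>PiM {..<n} (\<lambda>_. complex_gaussian))"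
  proof (rule nn_integral_PiM_Finner[OF prob_space_complex_gaussian finJ K, where S = "\<lambda>S. S"])
    show "card {S \<in> J. i \<in> S} = K" if "i \<in> {..<n}" for i
      using card_subsets_containing[OF _ that \<open>k > 0\<close>] by (simp add: J_def K_def conj_ac)
    show "h S \<in> borel_measurable (PiM {..<n} (\<lambda>_. complex_gaussian))" for S
      unfolding h_def s_def by measurable
    show "h S x = h S y" if "\<And>i. i \<in> S \<Longrightarrow> x i = y i" for S x y
    proof -
      have "s S x = s S y"
        unfolding s_def by (intro sum.cong) (use that in auto)
      then show ?thesis by (simp add: h_def)
    qed
  qed simp
  also have "\<dots> = (\<Prod>S\<in>J. \<integral>\<^sup>+z. ennreal (norm (F z) powr p) \<partial>complex_gaussian)"
  proof (rule prod.cong[OF refl])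
    fix S assume S: "S \<in> J"
    have "h S x ^ K = ennreal (norm (F (s S x)) powr p)" for x
      using K by (simp add: h_def ennreal_power powr_power_nonneg \<delta>_def)
    moreover have "sqrt (\<Sum>i<n. (if i \<in> S then 1 / sqrt k else 0)\<^sup>2) = 1"
    proof -
      have "(\<Sum>i<n. (if i \<in> S then 1 / sqrt k else 0)\<^sup>2) = (\<Sum>i\<in>S. 1 / real k)"
        using S by (intro sum.mono_neutral_cong_right) (auto simp: J_def power_divide)
      also have "\<dots> = 1" using S \<open>k > 0\<close> by (simp add: J_def)
      finally show ?thesis by simp
    qed
    ultimately show "(\<integral>\<^sup>+x. h S x ^ K \<partial>PiM {..<n} (\<lambda>_. complex_gaussian)) = (\<integral>\<^sup>+z. ennreal (norm (F z) powr p) \<partial>complex_gaussian)"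
      using nn_integral_complex_gaussian_PiM_sum[of "{..<n}" "\<lambda>z. ennreal (norm (F z) powr p)" "\<lambda>i. if i \<in> S then 1 / sqrt k else 0"]
      by (simp add: s_def)
  qed
  finally show ?thesis by (simp add: cardJ)
qed

lemma hypercontractive_rational:
  fixes F :: "complex ^ 'm \<Rightarrow> complex"
  assumes F: "entire_cn F" and "0 < p" and \<rho>: "\<rho> \<in> \<rat>" "0 < \<rho>" "\<rho> \<le> 1" and "a \<ge> 0"
    and a: "(\<integral>\<^sup>+s. ennreal (norm (F s) powr p) \<partial>complex_gaussian) \<le> ennreal a"
  shows "(\<integral>\<^sup>+s. ennreal (norm (F (sqrt \<rho> *\<^sub>R s)) powr (p / \<rho>)) \<partial>complex_gaussian) \<le> ennreal (a powr (1 / \<rho>))"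
proof -
  obtain k n :: nat where "n \<noteq> 0" and kn: "\<bar>\<rho>\<bar> = real k / real n"
    using Rats_abs_nat_div_natE[OF \<rho>(1)] by metis
  then have r: "\<rho> = real k / real n" and "real k = \<rho> * real n"
    using \<rho> by auto
  then have "0 < real k" "real k \<le> real n"
    using \<rho> \<open>n \<noteq> 0\<close> mult_right_mono[of \<rho> 1 "real n"] by auto
  then have k: "0 < k" "k \<le> n" by simp_all
  define K where "K = (n - 1) choose (k - 1)"
  have K: "K > 0" using k by (simp add: K_def)
  have NK: "real (n choose k) * real k = real n * real K"
    using times_binomial_minus1_eq[OF \<open>k > 0\<close>, of n] unfolding K_def
    by (metis mult.commute of_nat_mult)
  let ?X = "\<integral>\<^sup>+s. ennreal (norm (F (sqrt \<rho> *\<^sub>R s)) powr (p / \<rho>)) \<partial>complex_gaussian"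
  have "?X ^ K \<le> (\<integral>\<^sup>+s. ennreal (norm (F s) powr p) \<partial>complex_gaussian) ^ (n choose k)"
    using hypercontractive_rational_powers[OF F \<open>p > 0\<close> k] by (simp add: r K_def mult.commute)
  also have "\<dots> \<le> ennreal a ^ (n choose k)"
    by (rule power_mono_ennreal[OF a])
  also have "\<dots> = ennreal (a powr (1 / \<rho>)) ^ K"
  proof -
    have "a powr (real K * (1 / \<rho>)) = a powr real (n choose k)"
      using NK k by (intro arg_cong2[where f = "(powr)"]) (simp_all add: r field_simps)
    then have "(a powr (1 / \<rho>)) ^ K = a ^ (n choose k)"
      using K k \<open>a \<ge> 0\<close> by (simp add: powr_power_nonneg powr_realpow')
    then show ?thesis using \<open>a \<ge> 0\<close> by (simp add: ennreal_power)
  qed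
  finally show ?thesis
    by (rule ennreal_power_le_cancel[OF _ K])
qed

text \<open>
Monotonicity of \<open>L\<^sup>p\<close>-norms on a probability space, from Young's inequality for
\<open>f powr p / a\<close> and \<open>1\<close>.
\<close>

lemma (in prob_space) nn_integral_powr_Lyapunov:
  fixes f :: "'a \<Rightarrow> real"
  assumes [measurable]: "f \<in> borel_measurable M" and f: "\<And>x. f x \<ge> 0" and r: "0 < r" "r \<le> p"
    and "a \<ge> 0" and a: "(\<integral>\<^sup>+x. ennreal (f x powr p) \<partial>M) = ennreal a"
  shows "(\<integral>\<^sup>+x. ennreal (f x powr r) \<partial>M) \<le> ennreal (a powr (r / p))"
proof (cases "a = 0")
  case True
  then have "(\<integral>\<^sup>+x. ennreal (f x powr p) \<partial>M) = 0" using a by simp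
  then have "AE x in M. ennreal (f x powr p) = 0"
    by (subst (asm) nn_integral_0_iff_AE) auto
  then have "AE x in M. ennreal (f x powr r) = 0"
    by eventually_elim simp
  then have "(\<integral>\<^sup>+x. ennreal (f x powr r) \<partial>M) = 0"
    by (subst nn_integral_0_iff_AE) auto
  then show ?thesis by simp
next
  case False
  then have "a > 0" using \<open>a \<ge> 0\<close> by simp
  define \<theta> where "\<theta> = r / p"
  have \<theta>: "0 < \<theta>" "\<theta> \<le> 1" using r by (auto simp: \<theta>_def)
  have pt: "f x powr r \<le> a powr \<theta> * (\<theta> / a) * f x powr p + a powr \<theta> * (1 - \<theta>)" for x
  proof (cases "f x = 0")
    case True
    then show ?thesis using \<theta> by simp
  next
    case nz: False
    have "(f x powr p / a) powr \<theta> * 1 powr (1 - \<theta>) \<le> \<theta> * (f x powr p / a) + (1 - \<theta>) * 1"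
      by (rule Youngs_inequality_0) (use \<theta> \<open>a > 0\<close> nz in auto)
    moreover have "(f x powr p / a) powr \<theta> = f x powr r / a powr \<theta>"
      using \<open>a > 0\<close> r by (simp add: powr_divide powr_powr \<theta>_def)
    ultimately show ?thesis using \<open>a > 0\<close> by (simp add: field_simps)
  qed
  have "(\<integral>\<^sup>+x. ennreal (f x powr r) \<partial>M)
      \<le> (\<integral>\<^sup>+x. ennreal (a powr \<theta> * (\<theta> / a)) * ennreal (f x powr p) + ennreal (a powr \<theta> * (1 - \<theta>)) \<partial>M)"
    using \<theta> \<open>a > 0\<close> pt
    by (intro nn_integral_mono) (simp add: ennreal_mult[symmetric] ennreal_plus[symmetric] ennreal_leI del: ennreal_plus)
  also have "\<dots> = ennreal (a powr \<theta> * (\<theta> / a)) * ennreal a + ennreal (a powr \<theta> * (1 - \<theta>))"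
    by (simp add: nn_integral_add nn_integral_cmult a emeasure_space_1)
  also have "\<dots> = ennreal (a powr \<theta> * (\<theta> / a) * a + a powr \<theta> * (1 - \<theta>))"
    using \<theta> \<open>a > 0\<close> by (simp add: ennreal_mult[symmetric] ennreal_plus[symmetric] del: ennreal_plus)
  also have "a powr \<theta> * (\<theta> / a) * a + a powr \<theta> * (1 - \<theta>) = a powr (r / p)"
    using \<open>a > 0\<close> by (simp add: \<theta>_def field_simps)
  finally show ?thesis .
qed

text \<open>
A real ratio \<open>p / q\<close> is approached from below by rationals \<open>\<rho>\<close>. Lowering \<open>p\<close> to \<open>q * \<rho>\<close> does not
increase the norm of \<open>F\<close>, so the rational case bounds the \<open>L\<^sup>q\<close>-norms of the dilates by \<open>sqrt \<rho>\<close>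
with a constant that does not depend on \<open>\<rho>\<close>, and Fatou's lemma passes to the limit.
\<close>

lemma hypercontractive_nn_integral:
  fixes F :: "complex ^ 'm \<Rightarrow> complex"
  assumes F: "entire_cn F" and pq: "0 < p" "p < q" and "a \<ge> 0"
    and a: "(\<integral>\<^sup>+s. ennreal (norm (F s) powr p) \<partial>complex_gaussian) = ennreal a"
  shows "(\<integral>\<^sup>+s. ennreal (norm (F (sqrt (p / q) *\<^sub>R s)) powr q) \<partial>complex_gaussian) \<le> ennreal (a powr (q / p))"
proof -
  interpret prob_space "complex_gaussian :: (complex ^ 'm) measure"
    by (rule prob_space_complex_gaussian)
  have contF: "continuous_on S F" for S by (rule entire_cn_continuous_on[OF F])
  then have [measurable]: "F \<in> borel_measurable borel"
    by (intro borel_measurable_continuous_onI)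
  have "\<exists>\<rho>\<in>\<rat>. max 0 (p / q - 1 / real (Suc j)) < \<rho> \<and> \<rho> < p / q" for j
    by (rule Rats_dense_in_real) (use pq in auto)
  then obtain \<rho> where \<rho>: "\<And>j. \<rho> j \<in> \<rat>" "\<And>j. 0 < \<rho> j" "\<And>j. p / q - 1 / real (Suc j) < \<rho> j" "\<And>j. \<rho> j < p / q"
    by (metis max_less_iff_conj)
  have lim: "\<rho> \<longlonglongrightarrow> p / q"
  proof (rule tendsto_sandwich)
    have "(\<lambda>j. p / q - 1 / real (Suc j)) \<longlonglongrightarrow> p / q - 0"
      by (intro tendsto_diff tendsto_const LIMSEQ_Suc[OF lim_1_over_n])
    then show "(\<lambda>j. p / q - 1 / real (Suc j)) \<longlonglongrightarrow> p / q" by simp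
  qed (use \<rho> in \<open>auto intro!: always_eventually less_imp_le\<close>)
  define u where "u j s = ennreal (norm (F (sqrt (\<rho> j) *\<^sub>R s)) powr q)" for j s
  have bound: "(\<integral>\<^sup>+s. u j s \<partial>complex_gaussian) \<le> ennreal (a powr (q / p))" for j
  proof -
    have \<rho>q: "0 < q * \<rho> j" "q * \<rho> j \<le> p" "\<rho> j \<le> 1"
      using \<rho>(2,4)[of j] pq by (auto simp: field_simps intro: order.trans[of _ "p / q"] less_imp_le)
    have "(\<integral>\<^sup>+s. ennreal (norm (F s) powr (q * \<rho> j)) \<partial>complex_gaussian) \<le> ennreal (a powr (q * \<rho> j / p))"
      by (rule nn_integral_powr_Lyapunov) (use \<rho>q a \<open>a \<ge> 0\<close> in auto)
    from hypercontractive_rational[OF F \<rho>q(1) \<rho>(1,2) \<rho>q(3) _ this]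
    show ?thesis using \<rho>(2)[of j] pq by (simp add: u_def powr_powr)
  qed
  have "(\<integral>\<^sup>+s. ennreal (norm (F (sqrt (p / q) *\<^sub>R s)) powr q) \<partial>complex_gaussian)
      = (\<integral>\<^sup>+s. liminf (\<lambda>j. u j s) \<partial>complex_gaussian)"
  proof (rule nn_integral_cong)
    fix s :: "complex ^ 'm"
    have "(\<lambda>j. F (sqrt (\<rho> j) *\<^sub>R s)) \<longlonglongrightarrow> F (sqrt (p / q) *\<^sub>R s)"
      using contF[of UNIV] by (intro isCont_tendsto_compose[where g = F] tendsto_intros lim)
        (simp add: continuous_on_eq_continuous_at)
    then have "(\<lambda>j. u j s) \<longlonglongrightarrow> ennreal (norm (F (sqrt (p / q) *\<^sub>R s)) powr q)"
      unfolding u_def using pq by (intro tendsto_ennrealI tendsto_powr' tendsto_norm) auto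
    then show "ennreal (norm (F (sqrt (p / q) *\<^sub>R s)) powr q) = liminf (\<lambda>j. u j s)"
      by (intro lim_imp_Liminf[symmetric]) auto
  qed
  also have "\<dots> \<le> liminf (\<lambda>j. \<integral>\<^sup>+s. u j s \<partial>complex_gaussian)"
    by (rule nn_integral_liminf) (simp add: u_def)
  also have "\<dots> \<le> liminf (\<lambda>j :: nat. ennreal (a powr (q / p)))"
    by (intro Liminf_mono always_eventually allI bound)
  also have "\<dots> = ennreal (a powr (q / p))"
    by (simp add: Liminf_const)
  finally show ?thesis .
qed

theorem corollary7p8:
  fixes F :: "complex ^ 'm \<Rightarrow> complex" and p q :: real
  assumes "CARD('m) \<ge> 2"
    and "0 < p" and "p < q"
    and "entire_cn F"
    and "in_Lp p complex_gaussian F"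
  shows "in_Lp q complex_gaussian (\<lambda>\<xi>. F (sqrt (p / q) *\<^sub>R \<xi>)) \<and>
         (\<integral>\<xi>. norm (F (sqrt (p / q) *\<^sub>R \<xi>)) powr q \<partial>complex_gaussian) powr (1 / q)
           \<le> (\<integral>\<xi>. norm (F \<xi>) powr p \<partial>complex_gaussian) powr (1 / p)"
proof -
  define a where "a = (\<integral>\<xi>. norm (F \<xi>) powr p \<partial>complex_gaussian)"
  define b where "b = (\<integral>\<xi>. norm (F (sqrt (p / q) *\<^sub>R \<xi>)) powr q \<partial>complex_gaussian)"
  have [measurable]: "F \<in> borel_measurable borel"
    by (intro borel_measurable_continuous_onI entire_cn_continuous_on assms)
  have "a \<ge> 0" "b \<ge> 0" by (simp_all add: a_def b_def)
  have "(\<integral>\<^sup>+\<xi>. ennreal (norm (F \<xi>) powr p) \<partial>complex_gaussian) = ennreal a"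
    unfolding a_def using assms(5) by (intro nn_integral_eq_integral) (auto simp: in_Lp_def)
  from hypercontractive_nn_integral[OF assms(4,2,3) \<open>a \<ge> 0\<close> this]
  have le: "(\<integral>\<^sup>+\<xi>. ennreal (norm (F (sqrt (p / q) *\<^sub>R \<xi>)) powr q) \<partial>complex_gaussian) \<le> ennreal (a powr (q / p))" .
  have int: "integrable complex_gaussian (\<lambda>\<xi>. norm (F (sqrt (p / q) *\<^sub>R \<xi>)) powr q)"
    by (rule integrableI_bounded) (use le in \<open>auto intro: le_less_trans\<close>)
  then have "ennreal b = (\<integral>\<^sup>+\<xi>. ennreal (norm (F (sqrt (p / q) *\<^sub>R \<xi>)) powr q) \<partial>complex_gaussian)"
    unfolding b_def by (intro nn_integral_eq_integral[symmetric]) auto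
  with le have "ennreal b \<le> ennreal (a powr (q / p))" by (simp only:)
  then have "b \<le> a powr (q / p)" by simp
  then have "b powr (1 / q) \<le> (a powr (q / p)) powr (1 / q)"
    using \<open>b \<ge> 0\<close> assms by (intro powr_mono2) auto
  also have "\<dots> = a powr (1 / p)"
    using assms by (simp add: powr_powr)
  finally show ?thesis
    using int by (simp add: in_Lp_def a_def b_def)
qed

end
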